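(* Let $(L_t)_{t\ge 1}$ be the cumulative mark process of the discrete-time marked Hawkes process with parameters $\nu$, $\alpha$ and marks $\ell_{t,j}$ described in the context, where $\Vert\alpha\Vert_1\mathbb{E}[\ell_{1,1}]<1$. Then $\mathbb{P}(L_t/t\in\cdot)$ satisfies a large deviation principle on $\mathbb{R}$ with speed $t$ (as $t\to\infty$) and with the rate function $$I_L(x)=\sup_{\theta\le\theta_c}\{\theta x-\Gamma_L(\theta)\},\qquad x\in\mathbb{R},$$ where $\Gamma_L(\theta):=\nu(g_L(\theta)-1)$ and, for any $\theta\le\theta_c$, $g_L(\theta)$ is the minimal solution $x$ to the equation $$x=\mathbb{E}\left[e^{\theta\ell_{1,1}+\Vert\alpha\Vert_1\ell_{1,1}(x-1)}\right],$$ where $\theta_c>0$ satisfies the equation $$\mathbb{E}\left[\Vert\alpha\Vert_1\ell_{1,1}e^{\theta_c\ell_{1,1}+\Vert\alpha\Vert_1\ell_{1,1}(x_c-1)}\right]=1,$$ and where $x_c$ satisfies the equation $$x_c=\mathbb{E}\left[e^{\theta_c\ell_{1,1}+\Vert\alpha\Vert_1\ell_{1,1}(x_c-1)}\right].$$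
   Context: Discrete-time marked Hawkes process. Let $\mathbb{N}=\{1,2,\ldots\}$, let $\nu>0$ be a constant, let $\alpha:\mathbb{N}\to\mathbb{R}_+$ be a positive function, and let $\Vert\alpha\Vert_1:=\sum_{t=1}^\infty\alpha(t)$. Let $\ell_{t,j}$ ($t,j\in\mathbb{N}$) be positive random variables that are i.i.d. in both $t$ and $j$ (the marks). Set $X_0=N_0=0$. For each $t\ge 1$, conditional on the past $\mathcal{F}_{t-1}$ (the natural filtration up to time $t-1$, generated by $Z_s,X_s$ for $1\le s\le t-1$), $Z_t$ is a Poisson random variable with mean $$\lambda_t=\nu+\sum_{s=1}^{t-1}\alpha(s)X_{t-s},$$ and $X_t=\sum_{j=1}^{Z_t}\ell_{t,j}$, so that conditional on $\mathcal{F}_{t-1}$, $X_t$ is a compound Poisson random variable with intensity $\lambda_t$ and jump distribution that of $\ell_{1,1}$ (the marks $\ell_{t,j}$, $j\ge1$, being independent of $Z_t$ and of $\mathcal{F}_{t-1}$). Define $N_t:=\sum_{s=1}^tZ_s$ and $L_t:=\sum_{s=1}^tX_s$. Standing assumption: $\Vert\alpha\Vert_1\mathbb{E}[\ell_{1,1}]<1$. Large deviation principle. A family of probability measures $\{\mathbb{P}_n\}_{n\in\mathbb{N}}$ on a topological space $X$ satisfies the large deviation principle with rate function $I:X\to[0,\infty]$ and speed $a_n$ (positive and increasing to infinity) if $I$ is lower semi-continuous and for every Borel set $A$, $$-\inf_{x\in A^{o}}I(x)\le\liminf_{n\to\infty}\frac{1}{a_n}\log\mathbb{P}_n(A)\le\limsup_{n\to\infty}\frac{1}{a_n}\log\mathbb{P}_n(A)\le-\inf_{x\in\overline{A}}I(x),$$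 where $A^{o}$ and $\overline{A}$ are the interior and closure of $A$. *)

theory Defs
  imports "HOL-Probability.Probability"
begin

section \<open>Large deviation principles\<close>

definition lower_semicontinuous :: "('x::topological_space \<Rightarrow> ereal) \<Rightarrow> bool" where
  "lower_semicontinuous I \<longleftrightarrow> (\<forall>c. closed {x. I x \<le> c})"

text \<open>The library logarithm is real-valued with \<open>ln 0 = 0\<close>; here the value at 0 has to be
  \<open>-\<infinity>\<close>.\<close>
definition log_ereal :: "real \<Rightarrow> ereal" where
  "log_ereal p = (if p = 0 then -\<infinity> else ereal (ln p))"

text \<open>The families are indexed by \<open>{1,2,\<dots>}\<close>, so the values at index 0 are irrelevant.\<close>
definition satisfies_LDP ::
  "(nat \<Rightarrow> 'x::topological_space measure) \<Rightarrow> (nat \<Rightarrow> real) \<Rightarrow> ('x \<Rightarrow> ereal) \<Rightarrow> bool" where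
  "satisfies_LDP P a I \<longleftrightarrow>
     (\<forall>n\<ge>1. prob_space (P n) \<and> sets (P n) = sets borel) \<and>
     (\<forall>n\<ge>1. 0 < a n) \<and> mono_on {1..} a \<and> filterlim a at_top sequentially \<and>
     (\<forall>x. 0 \<le> I x) \<and> lower_semicontinuous I \<and>
     (\<forall>A\<in>sets borel.
        - (INF x\<in>interior A. I x)
            \<le> liminf (\<lambda>n. ereal (1 / a n) * log_ereal (measure (P n) A)) \<and>
        liminf (\<lambda>n. ereal (1 / a n) * log_ereal (measure (P n) A))
            \<le> limsup (\<lambda>n. ereal (1 / a n) * log_ereal (measure (P n) A)) \<and>
        limsup (\<lambda>n. ereal (1 / a n) * log_ereal (measure (P n) A))
            \<le> - (INF x\<in>closure A. I x))"

section \<open>The discrete-time marked Hawkes process\<close>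

text \<open>Time and mark indices start at 1; the values \<open>\<alpha> 0\<close>, \<open>l 0 j\<close>, \<open>l t 0\<close> and \<open>Z 0\<close> play
  no role.\<close>

definition norm1 :: "(nat \<Rightarrow> real) \<Rightarrow> real" where
  "norm1 \<alpha> = (\<Sum>t. \<alpha> (Suc t))"

definition hawkes_intensity ::
  "real \<Rightarrow> (nat \<Rightarrow> real) \<Rightarrow> (nat \<Rightarrow> 'a \<Rightarrow> real) \<Rightarrow> nat \<Rightarrow> 'a \<Rightarrow> real" where
  "hawkes_intensity \<nu> \<alpha> X t \<omega> = \<nu> + (\<Sum>s=1..t-1. \<alpha> s * X (t - s) \<omega>)"

definition cumulative_marks :: "(nat \<Rightarrow> 'a \<Rightarrow> real) \<Rightarrow> nat \<Rightarrow> 'a \<Rightarrow> real" where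
  "cumulative_marks X t \<omega> = (\<Sum>s=1..t. X s \<omega>)"

definition history ::
  "'a measure \<Rightarrow> (nat \<Rightarrow> 'a \<Rightarrow> nat) \<Rightarrow> (nat \<Rightarrow> 'a \<Rightarrow> real) \<Rightarrow> nat \<Rightarrow> 'a measure" where
  "history M Z X t = sigma (space M)
     ({Z s -` A \<inter> space M |s A. s \<in> {1..t}} \<union>
      {X s -` B \<inter> space M |s B. s \<in> {1..t} \<and> B \<in> sets borel})"

text \<open>The last two assumptions say that \<open>Z t\<close> is, conditionally on the past, Poisson with mean
  \<open>hawkes_intensity \<nu> \<alpha> X t\<close>, and that the marks of time \<open>t\<close> are independent of the pair (past,
  \<open>Z t\<close>). Independence of the pair, not just of each component, is what makes \<open>X t\<close>
  conditionally compound Poisson.\<close>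
locale marked_hawkes = prob_space M for M :: "'a measure" +
  fixes \<nu> :: real
    and \<alpha> :: "nat \<Rightarrow> real"
    and l :: "nat \<Rightarrow> nat \<Rightarrow> 'a \<Rightarrow> real"
    and Z :: "nat \<Rightarrow> 'a \<Rightarrow> nat"
    and X :: "nat \<Rightarrow> 'a \<Rightarrow> real"
  assumes nu_pos: "0 < \<nu>"
    and alpha_pos: "\<And>t. 1 \<le> t \<Longrightarrow> 0 < \<alpha> t"
    and marks_pos: "\<And>t j. 1 \<le> t \<Longrightarrow> 1 \<le> j \<Longrightarrow> AE \<omega> in M. 0 < l t j \<omega>"
    and marks_indep: "indep_vars (\<lambda>_. borel) (\<lambda>(t, j). l t j) ({1..} \<times> {1..})"
    and marks_ident:
      "\<And>t j. 1 \<le> t \<Longrightarrow> 1 \<le> j \<Longrightarrow> distr M borel (l t j) = distr M borel (l 1 1)"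
    and Z_measurable: "\<And>t. 1 \<le> t \<Longrightarrow> Z t \<in> measurable M (count_space UNIV)"
    and X_0: "\<And>\<omega>. X 0 \<omega> = 0"
    and X_eq: "\<And>t \<omega>. 1 \<le> t \<Longrightarrow> X t \<omega> = (\<Sum>j=1..Z t \<omega>. l t j \<omega>)"
    and Z_cond_poisson: "\<And>t k. 1 \<le> t \<Longrightarrow>
      AE \<omega> in M. real_cond_exp M (history M Z X (t - 1)) (indicator (Z t -` {k} \<inter> space M)) \<omega>
        = pmf (poisson_pmf (hawkes_intensity \<nu> \<alpha> X t \<omega>)) k"
    and marks_indep_past: "\<And>t. 1 \<le> t \<Longrightarrow>
      indep_set
        (sigma_sets (space M) (sets (history M Z X (t - 1)) \<union> {Z t -` A \<inter> space M |A. True}))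
        (sigma_sets (space M) {l t j -` B \<inter> space M |j B. 1 \<le> j \<and> B \<in> sets borel})"

section \<open>The rate function\<close>

text \<open>In the following, \<open>Y\<close> stands for a generic mark and \<open>a\<close> for the l1-norm of \<open>\<alpha>\<close>. Integrability
  is required explicitly, since a non-integrable function has integral 0 in the library.\<close>

definition mark_exp :: "('a \<Rightarrow> real) \<Rightarrow> real \<Rightarrow> real \<Rightarrow> real \<Rightarrow> 'a \<Rightarrow> real" where
  "mark_exp Y a \<theta> x \<omega> = exp (\<theta> * Y \<omega> + a * Y \<omega> * (x - 1))"

definition solves_g :: "'a measure \<Rightarrow> ('a \<Rightarrow> real) \<Rightarrow> real \<Rightarrow> real \<Rightarrow> real \<Rightarrow> bool" where
  "solves_g M Y a \<theta> x \<longleftrightarrow>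
     integrable M (mark_exp Y a \<theta> x) \<and> x = (\<integral>\<omega>. mark_exp Y a \<theta> x \<omega> \<partial>M)"

definition g_L :: "'a measure \<Rightarrow> ('a \<Rightarrow> real) \<Rightarrow> real \<Rightarrow> real \<Rightarrow> real" where
  "g_L M Y a \<theta> = (LEAST x. solves_g M Y a \<theta> x)"

definition Gamma_L :: "'a measure \<Rightarrow> ('a \<Rightarrow> real) \<Rightarrow> real \<Rightarrow> real \<Rightarrow> real \<Rightarrow> real" where
  "Gamma_L M Y a \<nu> \<theta> = \<nu> * (g_L M Y a \<theta> - 1)"

definition is_critical_pair ::
  "'a measure \<Rightarrow> ('a \<Rightarrow> real) \<Rightarrow> real \<Rightarrow> real \<Rightarrow> real \<Rightarrow> bool" where
  "is_critical_pair M Y a \<theta>c xc \<longleftrightarrow>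
     integrable M (\<lambda>\<omega>. a * Y \<omega> * mark_exp Y a \<theta>c xc \<omega>) \<and>
     (\<integral>\<omega>. a * Y \<omega> * mark_exp Y a \<theta>c xc \<omega> \<partial>M) = 1 \<and>
     solves_g M Y a \<theta>c xc"

definition rate_L ::
  "'a measure \<Rightarrow> ('a \<Rightarrow> real) \<Rightarrow> real \<Rightarrow> real \<Rightarrow> real \<Rightarrow> real \<Rightarrow> ereal" where
  "rate_L M Y a \<nu> \<theta>c x = (SUP \<theta>\<in>{..\<theta>c}. ereal (\<theta> * x - Gamma_L M Y a \<nu> \<theta>))"

end

theory Submission
  imports Defs
begin

text \<open>
  Conditioning on the past one step at a time gives, for every \<open>\<theta> \<le> \<theta>\<^sub>c\<close>,
  \<open>E exp (\<theta> L\<^sub>t) = exp (\<nu> \<Sum>\<^sub>k\<^sub><\<^sub>t (\<phi> (f\<^sub>k) - 1))\<close>, where \<open>\<phi>\<close> is the moment generating function of a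
  mark and \<open>f\<^sub>k = \<theta> + \<Sum>\<^sub>j\<^sub><\<^sub>k \<alpha>(k - j) (\<phi> (f\<^sub>j) - 1)\<close>. The sequence \<open>f\<close> is monotone and converges to
  the solution \<open>u\<close> of \<open>\<theta> = u - a (\<phi> (u) - 1)\<close>, \<open>a\<close> being the norm of \<open>\<alpha>\<close>; so the limiting cumulant
  is \<open>\<Gamma>\<^sub>L\<close>. Convexity of \<open>\<phi>\<close> makes \<open>u \<mapsto> u - a (\<phi> (u) - 1)\<close> increasing up to the critical point,
  where its derivative vanishes. Hence \<open>\<Gamma>\<^sub>L\<close> is steep at \<open>\<theta>\<^sub>c\<close>, its slopes exhaust \<open>(0, \<infinity>)\<close>, and the
  Chernoff bound and the tilting argument of Gaertner and Ellis apply although nothing is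
  known about the cumulants beyond \<open>\<theta>\<^sub>c\<close>.
\<close>

section \<open>One-sided Gaertner-Ellis theorem\<close>

text \<open>\<open>g_L\<close> is an implicit function of \<theta>, so all calculus is moved to the
  exponent u. There \<open>Gamma_L\<close> becomes \<nu> * (mgf u - 1), and its slope in \<theta> is
  \<nu> * dmgf u / (1 - a * dmgf u). This equals x exactly when dmgf u = x / (\<nu> + a * x); that
  is the origin of this fraction, which runs through (0, 1/a) as x runs through (0, \<infinity>),
  1/a being the value of \<open>dmgf\<close> at the critical exponent. No derivative is ever formed:
  strict tangent inequalities for exp, integrated over the mark, do the work of strict convexity.
  For the upper bound the cut at \<theta>c does no harm, since a closed set is split at the mean and
  each half lies in a single half-line. The obstacle in the lower bound is the point 0: its rate is
  finite, but every slope is positive, so no tilt centres the process there. It is reached through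
  points to its right whose rate is not larger.\<close>

lemma log_ereal_mono:
  assumes "0 \<le> p" "p \<le> q"
  shows "log_ereal p \<le> log_ereal q"
  using assms by (auto simp: log_ereal_def)

lemma liminf_log_ge:
  fixes p :: "nat \<Rightarrow> real"
  assumes "eventually (\<lambda>t. exp (- real t * c) \<le> p t) sequentially"
  shows "ereal (- c) \<le> liminf (\<lambda>t. ereal (1 / real t) * log_ereal (p t))"
proof (rule Liminf_bounded)
  show "eventually (\<lambda>t. ereal (- c) \<le> ereal (1 / real t) * log_ereal (p t)) sequentially"
    using assms eventually_gt_at_top[of 0]
  proof eventually_elim
    case (elim t)
    have p: "0 < p t" using elim(1) exp_gt_zero[of "- real t * c"] by linarith
    have "- real t * c \<le> ln (p t)" using elim(1) p by (simp add: ln_ge_iff)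
    then show ?case using elim(2) p by (simp add: log_ereal_def field_simps)
  qed
qed

lemma limsup_log_le:
  fixes p :: "nat \<Rightarrow> real"
  assumes "eventually (\<lambda>t. 0 \<le> p t \<and> p t \<le> exp (- real t * c)) sequentially"
  shows "limsup (\<lambda>t. ereal (1 / real t) * log_ereal (p t)) \<le> ereal (- c)"
proof (rule Limsup_bounded)
  show "eventually (\<lambda>t. ereal (1 / real t) * log_ereal (p t) \<le> ereal (- c)) sequentially"
    using assms eventually_gt_at_top[of 0]
  proof eventually_elim
    case (elim t)
    show ?case
    proof (cases "p t = 0")
      case True
      then show ?thesis using elim(2) by (simp add: log_ereal_def)
    next
      case False
      then have p: "0 < p t" using elim(1) by linarith
      then have "ln (p t) \<le> - real t * c" using elim(1) by (metis exp_le_cancel_iff exp_ln)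
      then show ?thesis using elim(2) p by (simp add: log_ereal_def field_simps)
    qed
  qed
qed

text \<open>The transforms are assumed only for exponents up to \<open>b\<close>, with
  \<open>b\<close> itself included. Writing them as \<open>exp (\<Lambda> t \<theta>)\<close> builds
  in positivity, so no logarithm of an integral has to be taken.\<close>

locale cgf_limit = prob_space M for M :: "'a measure" +
  fixes S :: "nat \<Rightarrow> 'a \<Rightarrow> real" and \<Lambda> :: "nat \<Rightarrow> real \<Rightarrow> real"
    and \<Gamma> :: "real \<Rightarrow> real" and b :: real
  assumes S_measurable [measurable]: "\<And>t. S t \<in> borel_measurable M"
    and S_integrable: "\<And>t \<theta>. \<theta> \<le> b \<Longrightarrow> integrable M (\<lambda>\<omega>. exp (\<theta> * S t \<omega>))"
    and S_mgf: "\<And>t \<theta>. \<theta> \<le> b \<Longrightarrow> (\<integral>\<omega>. exp (\<theta> * S t \<omega>) \<partial>M) = exp (\<Lambda> t \<theta>)"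
    and cgf_lim: "\<And>\<theta>. \<theta> \<le> b \<Longrightarrow> (\<lambda>t. \<Lambda> t \<theta> / real t) \<longlonglongrightarrow> \<Gamma> \<theta>"
begin

lemma cgf_eventually:
  assumes "\<theta> \<le> b" "0 < \<epsilon>"
  shows "eventually (\<lambda>t. real t * (\<Gamma> \<theta> - \<epsilon>) \<le> \<Lambda> t \<theta> \<and> \<Lambda> t \<theta> \<le> real t * (\<Gamma> \<theta> + \<epsilon>)) sequentially"
  using tendstoD[OF cgf_lim[OF assms(1)] assms(2)] eventually_gt_at_top[of 0]
proof eventually_elim
  case (elim t)
  have "\<Gamma> \<theta> - \<epsilon> \<le> \<Lambda> t \<theta> / real t" "\<Lambda> t \<theta> / real t \<le> \<Gamma> \<theta> + \<epsilon>"
    using elim(1) unfolding dist_real_def by linarith+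
  then show ?case
    using elim(2) by (simp add: field_simps)
qed

text \<open>Markov's inequality under the unnormalised tilted law: on the event, 1 is at most
  \<open>exp (h * (S t \<omega> - y))\<close>. The sign of \<open>h\<close> decides whether the
  event is an upper or a lower tail; \<theta> = 0 gives the Chernoff bound.\<close>

lemma tilted_tail_le:
  assumes "\<theta> + h \<le> b"
  shows "integrable M (\<lambda>\<omega>. exp (\<theta> * S t \<omega>) * indicator {\<omega>. h * y \<le> h * S t \<omega>} \<omega>)"
    and "(\<integral>\<omega>. exp (\<theta> * S t \<omega>) * indicator {\<omega>. h * y \<le> h * S t \<omega>} \<omega> \<partial>M)
      \<le> exp (\<Lambda> t (\<theta> + h) - h * y)"
proof -
  have le: "exp (\<theta> * S t \<omega>) * indicator {\<omega>. h * y \<le> h * S t \<omega>} \<omega>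
      \<le> exp (- h * y) * exp ((\<theta> + h) * S t \<omega>)" for \<omega>
    by (auto simp: indicator_def exp_add[symmetric] algebra_simps mult_exp_exp)
  have int: "integrable M (\<lambda>\<omega>. exp (- h * y) * exp ((\<theta> + h) * S t \<omega>))"
    using S_integrable[OF assms, of t] by simp
  show 1: "integrable M (\<lambda>\<omega>. exp (\<theta> * S t \<omega>) * indicator {\<omega>. h * y \<le> h * S t \<omega>} \<omega>)"
    by (rule Bochner_Integration.integrable_bound[OF int]) (use le in \<open>auto intro!: AE_I2 simp: abs_mult\<close>)
  have "(\<integral>\<omega>. exp (\<theta> * S t \<omega>) * indicator {\<omega>. h * y \<le> h * S t \<omega>} \<omega> \<partial>M)
      \<le> (\<integral>\<omega>. exp (- h * y) * exp ((\<theta> + h) * S t \<omega>) \<partial>M)"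
    using 1 int le by (rule integral_mono)
  also have "\<dots> = exp (- h * y) * exp (\<Lambda> t (\<theta> + h))"
    using S_mgf[OF assms, of t] by simp
  finally show "(\<integral>\<omega>. exp (\<theta> * S t \<omega>) * indicator {\<omega>. h * y \<le> h * S t \<omega>} \<omega> \<partial>M)
      \<le> exp (\<Lambda> t (\<theta> + h) - h * y)"
    by (simp add: exp_add[symmetric] algebra_simps mult_exp_exp)
qed

lemma prob_half_line_le:
  assumes "\<theta> \<le> b" "c < \<theta> * x - \<Gamma> \<theta>"
  shows "eventually (\<lambda>t. prob {\<omega>\<in>space M. \<theta> * (real t * x) \<le> \<theta> * S t \<omega>} \<le> exp (- real t * c)) sequentially"
proof -
  have "eventually (\<lambda>t. \<Lambda> t \<theta> \<le> real t * (\<Gamma> \<theta> + (\<theta> * x - \<Gamma> \<theta> - c))) sequentially"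
    using cgf_eventually[OF assms(1), of "\<theta> * x - \<Gamma> \<theta> - c"] assms(2)
    by (auto elim: eventually_mono)
  then show ?thesis
  proof eventually_elim
    case (elim t)
    have "prob {\<omega>\<in>space M. \<theta> * (real t * x) \<le> \<theta> * S t \<omega>}
        = (\<integral>\<omega>. exp (0 * S t \<omega>) * indicator {\<omega>. \<theta> * (real t * x) \<le> \<theta> * S t \<omega>} \<omega> \<partial>M)"
      by (simp add: Int_def conj_commute)
    also have "\<dots> \<le> exp (\<Lambda> t \<theta> - \<theta> * (real t * x))"
      using tilted_tail_le(2)[of 0 \<theta> t "real t * x"] assms(1) by simp
    also have "\<dots> \<le> exp (- real t * c)"
      using elim by (simp add: algebra_simps)
    finally show ?case .
  qed
qed

lemma prob_set_le:
  assumes "\<theta> \<le> b" "c < \<theta> * x - \<Gamma> \<theta>" and D: "\<And>y. y \<in> D \<Longrightarrow> \<theta> * x \<le> \<theta> * y"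
  shows "eventually (\<lambda>t. prob {\<omega>\<in>space M. S t \<omega> / real t \<in> D} \<le> exp (- real t * c)) sequentially"
  using prob_half_line_le[OF assms(1,2)] eventually_gt_at_top[of 0]
proof eventually_elim
  case (elim t)
  have "prob {\<omega>\<in>space M. S t \<omega> / real t \<in> D} \<le> prob {\<omega>\<in>space M. \<theta> * (real t * x) \<le> \<theta> * S t \<omega>}"
  proof (rule finite_measure_mono)
    show "{\<omega>\<in>space M. S t \<omega> / real t \<in> D} \<subseteq> {\<omega>\<in>space M. \<theta> * (real t * x) \<le> \<theta> * S t \<omega>}"
    proof safe
      fix \<omega> assume "S t \<omega> / real t \<in> D"
      then have "real t * (\<theta> * x) \<le> real t * (\<theta> * (S t \<omega> / real t))"
        by (intro mult_left_mono D) auto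
      then show "\<theta> * (real t * x) \<le> \<theta> * S t \<omega>" using elim(2) by (simp add: mult.left_commute)
    qed
  qed measurable
  with elim(1) show ?case by linarith
qed

text \<open>For h > 0 the last hypothesis says that the chord of \<Gamma> from \<theta> to \<theta>
  + h has slope below x, for h < 0 that it has slope above x. The tail then loses exponentially
  against the total mass \<open>exp (\<Lambda> t \<theta>)\<close>, so any fixed fraction of it,
  here 1/4, is reached.\<close>

lemma tilted_tail_small:
  assumes "\<theta> \<le> b" "\<theta> + h \<le> b" "\<Gamma> (\<theta> + h) - \<Gamma> \<theta> < h * x"
  shows "eventually (\<lambda>t. (\<integral>\<omega>. exp (\<theta> * S t \<omega>) *
      indicator {\<omega>. h * (real t * x) \<le> h * S t \<omega>} \<omega> \<partial>M) \<le> exp (\<Lambda> t \<theta>) / 4) sequentially"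
proof -
  \<comment> \<open>A third of the gap each for the errors of the two cumulants and for
    \<open>ln 4\<close>.\<close>
  define \<eta> where "\<eta> = (h * x - (\<Gamma> (\<theta> + h) - \<Gamma> \<theta>)) / 3"
  have \<eta>: "0 < \<eta>" using assms(3) by (simp add: \<eta>_def)
  have "eventually (\<lambda>t. ln 4 / \<eta> \<le> real t) sequentially"
    using filterlim_real_sequentially by (simp add: filterlim_at_top)
  then show ?thesis
    using cgf_eventually[OF assms(1) \<eta>] cgf_eventually[OF assms(2) \<eta>]
  proof eventually_elim
    case (elim t)
    have "ln 4 \<le> real t * \<eta>" using elim(1) \<eta> by (simp add: field_simps)
    moreover have "real t * (3 * \<eta>) = real t * (h * x - (\<Gamma> (\<theta> + h) - \<Gamma> \<theta>))"
      by (simp add: \<eta>_def)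
    ultimately have "\<Lambda> t (\<theta> + h) - h * (real t * x) \<le> \<Lambda> t \<theta> - ln 4"
      using elim(2,3) by (simp add: algebra_simps)
    then have "exp (\<Lambda> t (\<theta> + h) - h * (real t * x)) \<le> exp (\<Lambda> t \<theta> - ln 4)" by simp
    also have "exp (\<Lambda> t \<theta> - ln 4) = exp (\<Lambda> t \<theta>) / 4" by (subst exp_diff) simp
    finally show ?case
      using tilted_tail_le(2)[OF assms(2), of t "real t * x"] by linarith
  qed
qed

text \<open>Both inequalities hold when \<open>\<Gamma>\<close> is differentiable at \<open>\<theta> < b\<close> with derivative \<open>x\<close>; they are
  all that the change of measure needs.\<close>
definition exposed :: "real \<Rightarrow> real \<Rightarrow> bool" where
  "exposed \<theta> x \<longleftrightarrow> \<theta> \<le> b \<and>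
     (\<forall>\<delta>>0. \<exists>h>0. \<theta> + h \<le> b \<and> \<Gamma> (\<theta> + h) - \<Gamma> \<theta> < h * (x + \<delta>)) \<and>
     (\<forall>\<delta>>0. \<exists>h>0. \<Gamma> (\<theta> - h) - \<Gamma> \<theta> < - h * (x - \<delta>))"

text \<open>Under the law with density proportional to \<open>exp (\<theta> * S t)\<close> both tails around \<open>x\<close> have mass at
  most 1/4, so at least half of the mass stays near \<open>x\<close>.\<close>
lemma prob_ball_ge:
  assumes ex: "exposed \<theta> x" and "0 < \<delta>"
  shows "eventually (\<lambda>t. exp (\<Lambda> t \<theta> - real t * (\<theta> * x + \<bar>\<theta>\<bar> * \<delta>)) / 2
      \<le> prob {\<omega>\<in>space M. \<bar>S t \<omega> / real t - x\<bar> < \<delta>}) sequentially"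
proof -
  have \<theta>: "\<theta> \<le> b" using ex by (simp add: exposed_def)
  obtain h where h: "h > 0" "\<theta> + h \<le> b" "\<Gamma> (\<theta> + h) - \<Gamma> \<theta> < h * (x + \<delta>)"
    using ex assms(2) unfolding exposed_def by blast
  obtain k where k: "k > 0" "\<Gamma> (\<theta> - k) - \<Gamma> \<theta> < - k * (x - \<delta>)"
    using ex assms(2) unfolding exposed_def by blast
  have k': "\<theta> + - k \<le> b" "\<Gamma> (\<theta> + - k) - \<Gamma> \<theta> < - k * (x - \<delta>)" using k \<theta> by auto
  show ?thesis
    using tilted_tail_small[OF \<theta> h(2,3)] tilted_tail_small[OF \<theta> k'] eventually_gt_at_top[of 0]
  proof eventually_elim
    case (elim t)
    define U where "U = {\<omega>. h * (real t * (x + \<delta>)) \<le> h * S t \<omega>}"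
    define V where "V = {\<omega>. - k * (real t * (x - \<delta>)) \<le> - k * S t \<omega>}"
    define W where "W = {\<omega>\<in>space M. \<bar>S t \<omega> / real t - x\<bar> < \<delta>}"
    \<comment> \<open>\<open>B\<close> bounds the density
      \<open>exp (\<theta> * S t \<omega>)\<close> on the ball; the term with the absolute value of
      \<theta> covers both signs.\<close>
    define B where "B = exp (real t * (\<theta> * x + \<bar>\<theta>\<bar> * \<delta>))"
    have [measurable]: "W \<in> sets M" unfolding W_def by measurable
    have le: "exp (\<theta> * S t \<omega>) \<le> exp (\<theta> * S t \<omega>) * indicator U \<omega> + exp (\<theta> * S t \<omega>) * indicator V \<omega>
        + B * indicator W \<omega>" if "\<omega> \<in> space M" for \<omega>
    proof (cases "\<omega> \<in> W")
      case True
      then have "\<bar>S t \<omega> - real t * x\<bar> \<le> real t * \<delta>"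
        using elim(3) by (auto simp: W_def abs_if field_simps split: if_splits)
      then have "\<bar>\<theta> * (S t \<omega> - real t * x)\<bar> \<le> \<bar>\<theta>\<bar> * (real t * \<delta>)"
        by (simp add: abs_mult mult_left_mono)
      then have "\<theta> * S t \<omega> \<le> real t * (\<theta> * x + \<bar>\<theta>\<bar> * \<delta>)"
        by (simp add: algebra_simps)
      then have "exp (\<theta> * S t \<omega>) \<le> B" by (simp add: B_def)
      then show ?thesis using True by (simp add: add_increasing)
    next
      case False
      then have "S t \<omega> \<ge> real t * (x + \<delta>) \<or> S t \<omega> \<le> real t * (x - \<delta>)"
        using elim(3) that by (auto simp: W_def abs_if field_simps split: if_splits)
      then have "\<omega> \<in> U \<or> \<omega> \<in> V"
        using h(1) k(1) by (auto simp: U_def V_def)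
      then show ?thesis using False by (auto simp: add_increasing)
    qed
    have iU: "integrable M (\<lambda>\<omega>. exp (\<theta> * S t \<omega>) * indicator U \<omega>)"
      unfolding U_def by (rule tilted_tail_le(1)[OF h(2)])
    have iV: "integrable M (\<lambda>\<omega>. exp (\<theta> * S t \<omega>) * indicator V \<omega>)"
      unfolding V_def by (rule tilted_tail_le(1)[OF k'(1)])
    have iW: "integrable M (\<lambda>\<omega>. B * indicator W \<omega>)"
      by (intro integrable_mult_right integrable_real_indicator) (auto simp: emeasure_eq_measure)
    have "exp (\<Lambda> t \<theta>) = (\<integral>\<omega>. exp (\<theta> * S t \<omega>) \<partial>M)"
      by (rule S_mgf[OF \<theta>, symmetric])
    also have "\<dots> \<le> (\<integral>\<omega>. exp (\<theta> * S t \<omega>) * indicator U \<omega> + exp (\<theta> * S t \<omega>) * indicator V \<omega>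
        + B * indicator W \<omega> \<partial>M)"
      using le iU iV iW S_integrable[OF \<theta>] by (intro integral_mono) auto
    also have "\<dots> = (\<integral>\<omega>. exp (\<theta> * S t \<omega>) * indicator U \<omega> \<partial>M)
        + (\<integral>\<omega>. exp (\<theta> * S t \<omega>) * indicator V \<omega> \<partial>M) + B * prob W"
      using iU iV iW by simp
    also have "\<dots> \<le> exp (\<Lambda> t \<theta>) / 4 + exp (\<Lambda> t \<theta>) / 4 + B * prob W"
      using elim(1,2) unfolding U_def V_def by (intro add_mono) auto
    finally have "exp (\<Lambda> t \<theta>) / 2 \<le> B * prob W" by simp
    then show ?case
      unfolding W_def[symmetric] B_def by (simp add: exp_diff field_simps)
  qed
qed

definition rate :: "real \<Rightarrow> ereal" where
  "rate x = (SUP \<theta>\<in>{..b}. ereal (\<theta> * x - \<Gamma> \<theta>))"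

lemma rate_upper: "\<theta> \<le> b \<Longrightarrow> ereal (\<theta> * x - \<Gamma> \<theta>) \<le> rate x"
  unfolding rate_def by (rule SUP_upper) simp

lemma rate_lsc: "lower_semicontinuous rate"
  unfolding lower_semicontinuous_def
proof
  fix c
  have "{x. rate x \<le> c} = (\<Inter>\<theta>\<in>{..b}. {x. ereal (\<theta> * x - \<Gamma> \<theta>) \<le> c})"
    by (auto simp: rate_def SUP_le_iff)
  also have "closed \<dots>"
    by (intro closed_INT ballI closed_Collect_le continuous_intros)
  finally show "closed {x. rate x \<le> c}" .
qed

text \<open>The tilting argument yields the exponent at the exposing \<theta>, and this one member
  of the supremum is already at most \<open>rate x\<close>.\<close>

lemma prob_open_liminf:
  assumes ex: "exposed \<theta> x" and G: "open G" "x \<in> G"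
  shows "- rate x \<le> liminf (\<lambda>t. ereal (1 / real t) * log_ereal (prob {\<omega>\<in>space M. S t \<omega> / real t \<in> G}))"
    (is "_ \<le> ?L")
proof -
  have \<theta>: "\<theta> \<le> b" using ex by (simp add: exposed_def)
  have *: "ereal (- (\<theta> * x - \<Gamma> \<theta>) - \<epsilon>) \<le> ?L" if \<epsilon>: "0 < \<epsilon>" for \<epsilon>
  proof -
    obtain d where d: "0 < d" "ball x d \<subseteq> G" using G open_contains_ball by blast
    \<comment> \<open>\<epsilon> is shared by the width of the ball, the cumulant error and the
      factor 1/2; the \<open>+ 1\<close> guards against \<theta> = 0.\<close>
    define \<delta> where "\<delta> = min d (\<epsilon> / (3 * (\<bar>\<theta>\<bar> + 1)))"
    have \<delta>: "0 < \<delta>" "\<delta> \<le> d" using d(1) \<epsilon> by (auto simp: \<delta>_def)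
    have "\<delta> * (\<bar>\<theta>\<bar> + 1) \<le> \<epsilon> / 3"
    proof -
      have "\<delta> \<le> \<epsilon> / (3 * (\<bar>\<theta>\<bar> + 1))" by (simp add: \<delta>_def)
      then show ?thesis by (simp add: field_simps)
    qed
    then have \<delta>\<theta>: "\<bar>\<theta>\<bar> * \<delta> \<le> \<epsilon> / 3" using \<delta>(1) by (simp add: algebra_simps)
    have \<epsilon>3: "0 < \<epsilon> / 3" using \<epsilon> by simp
    have "eventually (\<lambda>t. 3 * ln 2 / \<epsilon> \<le> real t) sequentially"
      using filterlim_real_sequentially by (simp add: filterlim_at_top)
    then have "eventually (\<lambda>t. exp (- real t * (\<theta> * x - \<Gamma> \<theta> + \<epsilon>)) \<le> prob {\<omega>\<in>space M. S t \<omega> / real t \<in> G}) sequentially"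
      using prob_ball_ge[OF ex \<delta>(1)] cgf_eventually[OF \<theta> \<epsilon>3]
    proof eventually_elim
      case (elim t)
      have [measurable]: "G \<in> sets borel" using G(1) by simp
      have m: "{\<omega>\<in>space M. S t \<omega> / real t \<in> G} \<in> sets M" by measurable
      have sub: "{\<omega>\<in>space M. \<bar>S t \<omega> / real t - x\<bar> < \<delta>} \<subseteq> {\<omega>\<in>space M. S t \<omega> / real t \<in> G}"
        using d(2) \<delta>(2) by (auto simp: ball_def dist_real_def abs_minus_commute subset_iff)
      have "ln 2 \<le> real t * (\<epsilon> / 3)" using elim(1) \<epsilon> by (simp add: field_simps)
      moreover have "real t * (\<bar>\<theta>\<bar> * \<delta>) \<le> real t * (\<epsilon> / 3)" by (rule mult_left_mono[OF \<delta>\<theta>]) simp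
      moreover have "real t * (\<Gamma> \<theta> - \<epsilon> / 3) \<le> \<Lambda> t \<theta>" using elim by simp
      ultimately have "- real t * (\<theta> * x - \<Gamma> \<theta> + \<epsilon>) \<le> \<Lambda> t \<theta> - real t * (\<theta> * x + \<bar>\<theta>\<bar> * \<delta>) - ln 2"
        by (simp add: algebra_simps)
      then have "exp (- real t * (\<theta> * x - \<Gamma> \<theta> + \<epsilon>)) \<le> exp (\<Lambda> t \<theta> - real t * (\<theta> * x + \<bar>\<theta>\<bar> * \<delta>) - ln 2)"
        by simp
      also have "\<dots> = exp (\<Lambda> t \<theta> - real t * (\<theta> * x + \<bar>\<theta>\<bar> * \<delta>)) / 2"
        by (subst exp_diff) simp
      also have "\<dots> \<le> prob {\<omega>\<in>space M. \<bar>S t \<omega> / real t - x\<bar> < \<delta>}" using elim by simp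
      also have "\<dots> \<le> prob {\<omega>\<in>space M. S t \<omega> / real t \<in> G}"
        by (rule finite_measure_mono[OF sub m])
      finally show ?case by simp
    qed
    from liminf_log_ge[OF this] show ?thesis by simp
  qed
  have "ereal (- (\<theta> * x - \<Gamma> \<theta>)) \<le> ?L"
  proof (rule ereal_le_epsilon2)
    fix e :: real assume "0 < e"
    from *[OF this] show "ereal (- (\<theta> * x - \<Gamma> \<theta>)) \<le> ?L + ereal e"
      by (cases ?L) auto
  qed
  moreover have "- rate x \<le> ereal (- (\<theta> * x - \<Gamma> \<theta>))"
    using rate_upper[OF \<theta>, of x] by (metis ereal_minus_le_minus uminus_ereal.simps(1))
  ultimately show ?thesis by order
qed

text \<open>By \<open>mean\<close>, every exponent \<open>\<theta> * x - \<Gamma> \<theta>\<close>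
  is at most 0 at x = \<mu>. An exponent that beats a level c \<ge> 0 at x therefore has \<theta>
  pointing from \<mu> towards x, and its half-line contains everything beyond x. So on either side
  of \<mu> the point of \<open>C\<close> nearest to \<mu> controls the whole side, which replaces a
  compactness argument.\<close>

lemma prob_closed_limsup:
  assumes C: "closed C" and "0 \<le> b" and mean: "\<And>\<theta>. \<theta> \<le> b \<Longrightarrow> \<theta> * \<mu> \<le> \<Gamma> \<theta>"
  shows "limsup (\<lambda>t. ereal (1 / real t) * log_ereal (prob {\<omega>\<in>space M. S t \<omega> / real t \<in> C}))
    \<le> - (INF x\<in>C. rate x)" (is "?U \<le> _")
proof -
  have bound: "?U \<le> ereal (- c)" if c: "ereal c < (INF x\<in>C. rate x)" for c
  \<comment> \<open>A negative level is trivial, since probabilities are at most 1.\<close>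
  proof (cases "c < 0")
    case True
    have "eventually (\<lambda>t. 0 \<le> prob {\<omega>\<in>space M. S t \<omega> / real t \<in> C} \<and>
        prob {\<omega>\<in>space M. S t \<omega> / real t \<in> C} \<le> exp (- real t * c)) sequentially"
    proof (rule always_eventually, intro allI conjI)
      fix t
      have "prob {\<omega>\<in>space M. S t \<omega> / real t \<in> C} \<le> 1" by simp
      also have "1 \<le> exp (- real t * c)" using True by (simp add: mult_nonneg_nonpos)
      finally show "prob {\<omega>\<in>space M. S t \<omega> / real t \<in> C} \<le> exp (- real t * c)" .
    qed simp
    then show ?thesis by (rule limsup_log_le)
  next
    case False
    then have c0: "0 \<le> c" by simp
    have pt: "\<exists>\<theta>\<le>b. c < \<theta> * x - \<Gamma> \<theta>" if "x \<in> C" for x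
    proof -
      have "ereal c < rate x" using c that by (meson INF_lower less_le_trans)
      then show ?thesis by (auto simp: rate_def less_SUP_iff)
    qed
    \<comment> \<open>The decay rate c' has to exceed c strictly: the two sides are added later, and
      the gain absorbs the factor 2.\<close>
    have side: "\<exists>c'>c. eventually (\<lambda>t. prob {\<omega>\<in>space M. S t \<omega> / real t \<in> D} \<le> exp (- real t * c')) sequentially"
      if x: "x \<in> C" and D: "\<And>y. y \<in> D \<Longrightarrow> \<mu> \<le> x \<and> x \<le> y \<or> y \<le> x \<and> x \<le> \<mu>" for x D
    proof -
      obtain \<theta> where \<theta>: "\<theta> \<le> b" "c < \<theta> * x - \<Gamma> \<theta>" using pt x by blast
      obtain c' where c': "c < c'" "c' < \<theta> * x - \<Gamma> \<theta>" using dense[OF \<theta>(2)] by blast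
      have "\<theta> * \<mu> < \<theta> * x" using mean[OF \<theta>(1)] \<theta>(2) c0 by linarith
      then have "\<theta> * x \<le> \<theta> * y" if "y \<in> D" for y
        using D[OF that] by (auto simp: mult_less_cancel_left intro: mult_left_mono mult_left_mono_neg)
      from prob_set_le[OF \<theta>(1) c'(2) this] c'(1) show ?thesis by blast
    qed
    have right: "\<exists>c'>c. eventually (\<lambda>t. prob {\<omega>\<in>space M. S t \<omega> / real t \<in> C \<inter> {\<mu>..}} \<le> exp (- real t * c')) sequentially"
    proof (cases "C \<inter> {\<mu>..} = {}")
      case True
      then show ?thesis by (intro exI[of _ "c + 1"]) simp
    next
      case False
      have bdd: "bdd_below (C \<inter> {\<mu>..})" by (auto intro: bdd_belowI[of _ \<mu>])
      have "Inf (C \<inter> {\<mu>..}) \<in> C \<inter> {\<mu>..}"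
        using C False bdd by (intro closed_contains_Inf closed_Int) auto
      then show ?thesis
        using cInf_lower[OF _ bdd] by (intro side[of "Inf (C \<inter> {\<mu>..})"]) auto
    qed
    have left: "\<exists>c'>c. eventually (\<lambda>t. prob {\<omega>\<in>space M. S t \<omega> / real t \<in> C \<inter> {..\<mu>}} \<le> exp (- real t * c')) sequentially"
    proof (cases "C \<inter> {..\<mu>} = {}")
      case True
      then show ?thesis by (intro exI[of _ "c + 1"]) simp
    next
      case False
      have bdd: "bdd_above (C \<inter> {..\<mu>})" by (auto intro: bdd_aboveI[of _ \<mu>])
      have "Sup (C \<inter> {..\<mu>}) \<in> C \<inter> {..\<mu>}"
        using C False bdd by (intro closed_contains_Sup closed_Int) auto
      then show ?thesis
        using cSup_upper[OF _ bdd] by (intro side[of "Sup (C \<inter> {..\<mu>})"]) auto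
    qed
    obtain c1 c2 where c12: "c1 > c" "c2 > c"
      "eventually (\<lambda>t. prob {\<omega>\<in>space M. S t \<omega> / real t \<in> C \<inter> {\<mu>..}} \<le> exp (- real t * c1)) sequentially"
      "eventually (\<lambda>t. prob {\<omega>\<in>space M. S t \<omega> / real t \<in> C \<inter> {..\<mu>}} \<le> exp (- real t * c2)) sequentially"
      using left right by blast
    define \<eta> where "\<eta> = min c1 c2 - c"
    have \<eta>: "0 < \<eta>" using c12 by (simp add: \<eta>_def)
    have "eventually (\<lambda>t. ln 2 / \<eta> \<le> real t) sequentially"
      using filterlim_real_sequentially by (simp add: filterlim_at_top)
    then have "eventually (\<lambda>t. 0 \<le> prob {\<omega>\<in>space M. S t \<omega> / real t \<in> C} \<and>
        prob {\<omega>\<in>space M. S t \<omega> / real t \<in> C} \<le> exp (- real t * c)) sequentially"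
      using c12(3,4)
    proof eventually_elim
      case (elim t)
      have [measurable]: "C \<in> sets borel" using C by simp
      have [measurable]: "{\<omega>\<in>space M. S t \<omega> / real t \<in> C \<inter> {\<mu>..}} \<in> sets M"
        "{\<omega>\<in>space M. S t \<omega> / real t \<in> C \<inter> {..\<mu>}} \<in> sets M"
        by measurable
      have "{\<omega>\<in>space M. S t \<omega> / real t \<in> C} = {\<omega>\<in>space M. S t \<omega> / real t \<in> C \<inter> {\<mu>..}} \<union> {\<omega>\<in>space M. S t \<omega> / real t \<in> C \<inter> {..\<mu>}}"
        by auto
      then have "prob {\<omega>\<in>space M. S t \<omega> / real t \<in> C} \<le> prob {\<omega>\<in>space M. S t \<omega> / real t \<in> C \<inter> {\<mu>..}} + prob {\<omega>\<in>space M. S t \<omega> / real t \<in> C \<inter> {..\<mu>}}"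
        by (simp add: measure_Un_le)
      also have "\<dots> \<le> exp (- real t * c1) + exp (- real t * c2)" using elim by linarith
      also have "\<dots> \<le> exp (- real t * (c + \<eta>)) + exp (- real t * (c + \<eta>))"
        by (intro add_mono) (auto simp: \<eta>_def intro!: mult_left_mono)
      also have "\<dots> = exp (ln 2 - real t * \<eta>) * exp (- real t * c)"
        by (simp add: exp_diff exp_add exp_minus algebra_simps divide_inverse)
      also have "\<dots> \<le> 1 * exp (- real t * c)"
        using elim(1) \<eta> by (intro mult_right_mono) (auto simp: field_simps)
      finally show ?case by simp
    qed
    then show ?thesis by (rule limsup_log_le)
  qed
  \<comment> \<open>Approaching the infimum from below by real levels also covers an infinite
    infimum.\<close>
  have "(INF x\<in>C. rate x) \<le> - ?U"
  proof (rule dense_le)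
    fix z assume z: "z < (INF x\<in>C. rate x)"
    show "z \<le> - ?U"
    proof (cases z)
      case (real c)
      then have "?U \<le> - z" using bound[of c] z by simp
      then have "- (- z) \<le> - ?U" by (simp only: ereal_minus_le_minus)
      then show ?thesis by (simp only: ereal_uminus_uminus)
    qed (use z in auto)
  qed
  then have "- (- ?U) \<le> - (INF x\<in>C. rate x)" by (simp only: ereal_minus_le_minus)
  then show ?thesis by (simp only: ereal_uminus_uminus)
qed

text \<open>By \<open>ex\<close>, a point of finite rate need only have exposed points of no larger
  rate in each of its neighbourhoods. At points of infinite rate the lower bound is trivial.\<close>

lemma LDP:
  assumes b: "0 < b" and mean: "\<And>\<theta>. \<theta> \<le> b \<Longrightarrow> \<theta> * \<mu> \<le> \<Gamma> \<theta>" and \<Gamma>0: "\<Gamma> 0 = 0"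
    and ex: "\<And>x G. open G \<Longrightarrow> x \<in> G \<Longrightarrow> rate x < \<infinity> \<Longrightarrow> \<exists>y\<in>G. rate y \<le> rate x \<and> (\<exists>\<theta>. exposed \<theta> y)"
  shows "satisfies_LDP (\<lambda>t. distr M borel (\<lambda>\<omega>. S t \<omega> / real t)) real rate"
proof -
  have meas: "measure (distr M borel (\<lambda>\<omega>. S t \<omega> / real t)) A = prob {\<omega>\<in>space M. S t \<omega> / real t \<in> A}"
    if "A \<in> sets borel" for A t
    using that by (subst measure_distr) (auto intro!: arg_cong[where f=prob])
  show ?thesis
    unfolding satisfies_LDP_def
  proof (intro conjI allI impI ballI)
    show "prob_space (distr M borel (\<lambda>\<omega>. S n \<omega> / real n))" for n
      by (rule prob_space_distr) measurable
    show "sets (distr M borel (\<lambda>\<omega>. S n \<omega> / real n)) = sets borel" for n by simp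
    show "0 < real n" if "1 \<le> n" for n using that by simp
    show "mono_on {1..} real" by (auto intro: mono_onI)
    show "filterlim real at_top sequentially" by (rule filterlim_real_sequentially)
    show "0 \<le> rate x" for x
      using rate_upper[of 0 x] b \<Gamma>0 by (simp add: zero_ereal_def)
    show "lower_semicontinuous rate" by (rule rate_lsc)
  next
    fix A :: "real set" assume A [measurable]: "A \<in> sets borel"
    let ?p = "\<lambda>A t. prob {\<omega>\<in>space M. S t \<omega> / real t \<in> A}"
    let ?l = "\<lambda>n. ereal (1 / real n) * log_ereal (measure (distr M borel (\<lambda>\<omega>. S n \<omega> / real n)) A)"
    have l: "?l = (\<lambda>t. ereal (1 / real t) * log_ereal (?p A t))"
      using A by (simp add: meas)
    have up: "?p A t \<le> ?p (closure A) t" for t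
    proof (rule finite_measure_mono)
      have [measurable]: "closure A \<in> sets borel" by simp
      show "{\<omega>\<in>space M. S t \<omega> / real t \<in> closure A} \<in> sets M" by measurable
    qed (use closure_subset[of A] in auto)
    have low: "?p (interior A) t \<le> ?p A t" for t
      using interior_subset[of A] by (intro finite_measure_mono) auto
    show "liminf ?l \<le> limsup ?l" by (rule Liminf_le_Limsup) simp
    have "limsup ?l \<le> limsup (\<lambda>t. ereal (1 / real t) * log_ereal (?p (closure A) t))"
      unfolding l by (intro Limsup_mono always_eventually allI ereal_mult_left_mono log_ereal_mono up) auto
    also have "\<dots> \<le> - (INF x\<in>closure A. rate x)"
      using b mean by (intro prob_closed_limsup) auto
    finally show "limsup ?l \<le> - (INF x\<in>closure A. rate x)" .
    have "- rate x \<le> liminf ?l" if x: "x \<in> interior A" for x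
    proof (cases "rate x < \<infinity>")
      case True
      obtain y \<theta> where y: "y \<in> interior A" "rate y \<le> rate x" "exposed \<theta> y"
        using ex[OF open_interior x True] by blast
      have "- rate x \<le> - rate y" using y(2) by simp
      also have "\<dots> \<le> liminf (\<lambda>t. ereal (1 / real t) * log_ereal (?p (interior A) t))"
        using y by (intro prob_open_liminf) auto
      also have "\<dots> \<le> liminf ?l"
        unfolding l by (intro Liminf_mono always_eventually allI ereal_mult_left_mono log_ereal_mono low) auto
      finally show ?thesis .
    qed simp
    then have "- liminf ?l \<le> rate x" if "x \<in> interior A" for x
      using iffD1[OF ereal_uminus_le_reorder, of "rate x"] that by blast
    then have "- liminf ?l \<le> (INF x\<in>interior A. rate x)" by (rule INF_greatest)
    then show "- (INF x\<in>interior A. rate x) \<le> liminf ?l"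
      by (rule iffD1[OF ereal_uminus_le_reorder])
  qed
qed

end

section \<open>The fixed point equation\<close>

lemma cesaro_mean:
  fixes c :: "nat \<Rightarrow> real"
  assumes c: "c \<longlonglongrightarrow> L"
  shows "(\<lambda>n. (\<Sum>k<n. c k) / real n) \<longlonglongrightarrow> L"
proof (rule LIMSEQ_I)
  fix e :: real assume e: "0 < e"
  obtain N where N: "\<And>k. k \<ge> N \<Longrightarrow> \<bar>c k - L\<bar> < e / 2"
    using LIMSEQ_D[OF c, of "e / 2"] e by auto
  define K where "K = (\<Sum>k<N. \<bar>c k - L\<bar>)"
  obtain n0 :: nat where n0: "2 * K / e < real n0" using reals_Archimedean2 by blast
  show "\<exists>no. \<forall>n\<ge>no. norm ((\<Sum>k<n. c k) / real n - L) < e"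
  proof (intro exI allI impI)
    fix n assume n: "max (Suc n0) N \<le> n"
    then have npos: "0 < real n" by simp
    have "2 * K / e < real n" using n0 n by linarith
    then have Kn: "K < real n * e / 2" using e by (simp add: field_simps)
    have "(\<Sum>k<n. c k) - real n * L = (\<Sum>k<n. c k - L)" by (simp add: sum_subtractf)
    then have "\<bar>(\<Sum>k<n. c k) - real n * L\<bar> \<le> (\<Sum>k<n. \<bar>c k - L\<bar>)" by simp
    also have "{..<n} = {..<N} \<union> {N..<n}" using n by auto
    then have "(\<Sum>k<n. \<bar>c k - L\<bar>) = K + (\<Sum>k=N..<n. \<bar>c k - L\<bar>)"
      by (simp add: K_def sum.union_disjoint ivl_disj_int)
    also have "(\<Sum>k=N..<n. \<bar>c k - L\<bar>) \<le> (\<Sum>k=N..<n. e / 2)"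
      using N by (intro sum_mono) (auto intro: less_imp_le)
    also have "\<dots> \<le> real n * (e / 2)" using e by (simp add: mult_right_mono)
    finally have "\<bar>(\<Sum>k<n. c k) - real n * L\<bar> < real n * e" using Kn by simp
    then have "\<bar>(\<Sum>k<n. c k) - real n * L\<bar> / real n < e" using npos by (simp add: field_simps)
    moreover have "(\<Sum>k<n. c k) / real n - L = ((\<Sum>k<n. c k) - real n * L) / real n"
      using npos by (simp add: field_simps)
    ultimately show "norm ((\<Sum>k<n. c k) / real n - L) < e" by simp
  qed
qed

text \<open>With \<open>j = n - Suc s\<close> the summand for fixed s converges, and
  \<open>\<bar>\<alpha> (Suc s)\<bar> * B\<close> dominates it for all n, so Tannery's theorem
  exchanges limit and sum.\<close>

lemma convolution_tendsto:
  fixes \<alpha> c :: "nat \<Rightarrow> real"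
  assumes sum: "summable (\<lambda>s. \<bar>\<alpha> (Suc s)\<bar>)" and c: "c \<longlonglongrightarrow> L"
  shows "(\<lambda>n. \<Sum>j<n. \<alpha> (n - j) * c j) \<longlonglongrightarrow> (\<Sum>s. \<alpha> (Suc s)) * L"
proof -
  obtain B where B: "\<And>j. \<bar>c j\<bar> \<le> B"
    using c convergent_imp_Bseq[of c] by (auto simp: convergent_def Bseq_def)
  have "0 \<le> B" using B[of 0] by simp
  define a where "a s n = (if s < n then \<alpha> (Suc s) * c (n - Suc s) else 0)" for s n
  have lim: "(\<lambda>n. a s n) \<longlonglongrightarrow> \<alpha> (Suc s) * L" for s
  proof -
    have "(\<lambda>n. c (n - Suc s)) \<longlonglongrightarrow> L"
      by (rule LIMSEQ_offset[of _ "Suc s"]) (use c in simp)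
    then have "(\<lambda>n. \<alpha> (Suc s) * c (n - Suc s)) \<longlonglongrightarrow> \<alpha> (Suc s) * L" by (intro tendsto_intros)
    moreover have "eventually (\<lambda>n. \<alpha> (Suc s) * c (n - Suc s) = a s n) sequentially"
      using eventually_gt_at_top[of s] by eventually_elim (simp add: a_def)
    ultimately show ?thesis by (rule Lim_transform_eventually)
  qed
  have "(\<lambda>n. suminf (\<lambda>s. a s n)) \<longlonglongrightarrow> (\<Sum>s. \<alpha> (Suc s) * L)"
  proof (rule tannerys_theorem[THEN conjunct2, THEN conjunct2])
    show "eventually (\<lambda>(s, n). norm (a s n) \<le> \<bar>\<alpha> (Suc s)\<bar> * B) (at_top \<times>\<^sub>F sequentially)"
      by (rule always_eventually) (use B \<open>0 \<le> B\<close> in \<open>auto simp: a_def abs_mult intro: mult_left_mono\<close>)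
    show "summable (\<lambda>s. \<bar>\<alpha> (Suc s)\<bar> * B)" by (rule summable_mult2[OF sum])
  qed (use lim in auto)
  moreover have "suminf (\<lambda>s. a s n) = (\<Sum>j<n. \<alpha> (n - j) * c j)" for n
  proof -
    have "suminf (\<lambda>s. a s n) = (\<Sum>s<n. a s n)"
      by (rule suminf_finite) (auto simp: a_def)
    also have "\<dots> = (\<Sum>s<n. a (n - Suc s) n)" by (rule sum.nat_diff_reindex[symmetric])
    also have "\<dots> = (\<Sum>j<n. \<alpha> (n - j) * c j)"
      by (intro sum.cong) (auto simp: a_def Suc_diff_Suc)
    finally show ?thesis .
  qed
  moreover have "(\<Sum>s. \<alpha> (Suc s) * L) = (\<Sum>s. \<alpha> (Suc s)) * L"
    using summable_rabs_cancel[OF sum] by (rule suminf_mult2[symmetric])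
  ultimately show ?thesis by simp
qed

text \<open>Squaring \<open>1 + x / 2 \<le> exp (x / 2)\<close> gains the term x^2 / 4, which makes
  the inequality strict.\<close>

lemma exp_gt_add_one:
  fixes x :: real
  assumes "x \<noteq> 0"
  shows "1 + x < exp x"
proof (cases "1 + x / 2 \<le> 0")
  case True
  then have "1 + x \<le> 0" by simp
  then show ?thesis using exp_gt_zero[of x] by linarith
next
  case False
  have "1 + x < (1 + x / 2) * (1 + x / 2)"
    using assms not_square_less_zero[of x] by (simp add: algebra_simps less_le)
  also have "\<dots> \<le> exp (x / 2) * exp (x / 2)"
    using False exp_ge_add_one_self[of "x / 2"] by (intro mult_mono) auto
  also have "\<dots> = exp x" by (simp add: exp_add[symmetric])
  finally show ?thesis .
qed

lemma exp_tangent_less: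
  fixes u v y :: real
  assumes "u \<noteq> v" "y \<noteq> 0"
  shows "y * exp (u * y) * (v - u) < exp (v * y) - exp (u * y)"
proof -
  have "exp (u * y) * (1 + (v - u) * y) < exp (u * y) * exp ((v - u) * y)"
    using exp_gt_add_one[of "(v - u) * y"] assms by (intro mult_strict_left_mono) auto
  then show ?thesis by (simp add: exp_add[symmetric] algebra_simps)
qed

section \<open>The moment generating function of one mark and the map \<open>tilt\<close>\<close>

locale critical_mark = prob_space M for M :: "'a measure" +
  fixes Y :: "'a \<Rightarrow> real" and a \<theta>c xc :: real
  assumes Y_pos: "AE \<omega> in M. 0 < Y \<omega>"
    and Y_integrable: "integrable M Y"
    and a_pos: "0 < a"
    and subcritical: "a * (\<integral>\<omega>. Y \<omega> \<partial>M) < 1"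
    and critical: "is_critical_pair M Y a \<theta>c xc"
begin

lemma Y_measurable [measurable]: "Y \<in> borel_measurable M"
  using Y_integrable by auto

definition mgf :: "real \<Rightarrow> real" where
  "mgf u = (\<integral>\<omega>. exp (u * Y \<omega>) \<partial>M)"

text \<open>The derivative of \<open>mgf\<close>, given directly as an integral; its link to
  \<open>mgf\<close> is the tangent inequality \<open>mgf_tangent_less\<close>, not a limit.\<close>

definition dmgf :: "real \<Rightarrow> real" where
  "dmgf u = (\<integral>\<omega>. Y \<omega> * exp (u * Y \<omega>) \<partial>M)"

definition uc :: real where "uc = \<theta>c + a * (xc - 1)"

text \<open>Writing a solution \<open>x\<close> of the fixed point equation at \<open>\<theta>\<close> as \<open>x = mgf u\<close> with
  \<open>u = \<theta> + a (x - 1)\<close>, the equation becomes \<open>\<theta> = tilt u\<close>.\<close>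
definition tilt :: "real \<Rightarrow> real" where "tilt u = u - a * (mgf u - 1)"

lemma mark_exp_eq: "mark_exp Y a \<theta> x = (\<lambda>\<omega>. exp ((\<theta> + a * (x - 1)) * Y \<omega>))"
  by (auto simp: mark_exp_def algebra_simps)

text \<open>Since Y is positive, all exponents up to w are dominated by w itself. This gives
  continuity on the closed half-line, endpoint included, which matters at the critical exponent. It
  is applied with h = 1 and with h = Y.\<close>

lemma dominated:
  assumes [measurable]: "h \<in> borel_measurable M" and h: "AE \<omega> in M. 0 \<le> h \<omega>"
    and int: "integrable M (\<lambda>\<omega>. h \<omega> * exp (w * Y \<omega>))"
  shows "u \<le> w \<Longrightarrow> integrable M (\<lambda>\<omega>. h \<omega> * exp (u * Y \<omega>))"
    and "continuous_on {..w} (\<lambda>u. \<integral>\<omega>. h \<omega> * exp (u * Y \<omega>) \<partial>M)"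
    and "(\<lambda>n. \<integral>\<omega>. h \<omega> * exp (- real n * Y \<omega>) \<partial>M) \<longlonglongrightarrow> 0"
proof -
  have bound: "AE \<omega> in M. norm (h \<omega> * exp (u * Y \<omega>)) \<le> h \<omega> * exp (w * Y \<omega>)" if "u \<le> w" for u
    using h Y_pos by eventually_elim (use that in \<open>auto simp: abs_mult intro!: mult_left_mono mult_right_mono\<close>)
  show "integrable M (\<lambda>\<omega>. h \<omega> * exp (u * Y \<omega>))" if "u \<le> w" for u
    by (rule Bochner_Integration.integrable_bound[OF int]) (use bound[OF that] in auto)
  show "continuous_on {..w} (\<lambda>u. \<integral>\<omega>. h \<omega> * exp (u * Y \<omega>) \<partial>M)"
  proof (rule continuous_on_sequentiallyI)
    fix u :: "nat \<Rightarrow> real" and v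
    assume u: "\<forall>n. u n \<in> {..w}" and "v \<in> {..w}" and lim: "u \<longlonglongrightarrow> v"
    show "(\<lambda>n. \<integral>\<omega>. h \<omega> * exp (u n * Y \<omega>) \<partial>M) \<longlonglongrightarrow> (\<integral>\<omega>. h \<omega> * exp (v * Y \<omega>) \<partial>M)"
    proof (rule integral_dominated_convergence[OF _ _ int])
      show "AE \<omega> in M. (\<lambda>n. h \<omega> * exp (u n * Y \<omega>)) \<longlonglongrightarrow> h \<omega> * exp (v * Y \<omega>)"
        by (intro AE_I2 tendsto_intros lim)
      show "AE \<omega> in M. norm (h \<omega> * exp (u n * Y \<omega>)) \<le> h \<omega> * exp (w * Y \<omega>)" for n
        using u by (intro bound) auto
    qed measurable
  qed
  \<comment> \<open>After a shift by N all exponents are below w, so that the domination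
    applies.\<close>
  obtain N :: nat where N: "- w < real N" using reals_Archimedean2 by blast
  have "(\<lambda>n. \<integral>\<omega>. h \<omega> * exp (- real (n + N) * Y \<omega>) \<partial>M) \<longlonglongrightarrow> (\<integral>\<omega>. 0 \<partial>M)"
  proof (rule integral_dominated_convergence[OF _ _ int])
    show "AE \<omega> in M. (\<lambda>n. h \<omega> * exp (- real (n + N) * Y \<omega>)) \<longlonglongrightarrow> 0"
      using Y_pos
    proof eventually_elim
      case (elim \<omega>)
      have "(\<lambda>n. exp (- Y \<omega>) ^ n) \<longlonglongrightarrow> 0"
        using elim by (intro LIMSEQ_power_zero) auto
      then have "(\<lambda>n. exp (- real n * Y \<omega>)) \<longlonglongrightarrow> 0"
        by (simp add: exp_of_nat_mult[symmetric])
      then have "(\<lambda>n. exp (- real (n + N) * Y \<omega>)) \<longlonglongrightarrow> 0"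
        by (rule LIMSEQ_ignore_initial_segment)
      then show ?case by (rule tendsto_mult_right_zero)
    qed
    show "AE \<omega> in M. norm (h \<omega> * exp (- real (n + N) * Y \<omega>)) \<le> h \<omega> * exp (w * Y \<omega>)" for n
      using N by (intro bound) auto
  qed measurable
  then have "(\<lambda>n. \<integral>\<omega>. h \<omega> * exp (- real (n + N) * Y \<omega>) \<partial>M) \<longlonglongrightarrow> 0" by simp
  then show "(\<lambda>n. \<integral>\<omega>. h \<omega> * exp (- real n * Y \<omega>) \<partial>M) \<longlonglongrightarrow> 0"
    by (rule LIMSEQ_offset)
qed

lemma Y_nonneg: "AE \<omega> in M. 0 \<le> Y \<omega>"
  using Y_pos by eventually_elim simp

lemma critical_integrable: "integrable M (\<lambda>\<omega>. exp (uc * Y \<omega>))"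
  "integrable M (\<lambda>\<omega>. Y \<omega> * exp (uc * Y \<omega>))"
proof -
  have eq: "mark_exp Y a \<theta>c xc = (\<lambda>\<omega>. exp (uc * Y \<omega>))" by (simp add: mark_exp_eq uc_def)
  show "integrable M (\<lambda>\<omega>. exp (uc * Y \<omega>))"
    using critical eq by (simp add: is_critical_pair_def solves_g_def)
  have "integrable M (\<lambda>\<omega>. a * Y \<omega> * exp (uc * Y \<omega>))"
    using critical eq by (simp add: is_critical_pair_def)
  then have "integrable M (\<lambda>\<omega>. (1 / a) * (a * Y \<omega> * exp (uc * Y \<omega>)))" by (rule integrable_mult_right)
  then show "integrable M (\<lambda>\<omega>. Y \<omega> * exp (uc * Y \<omega>))" using a_pos by (simp add: mult.assoc)
qed

lemma exp_integrable: "u \<le> uc \<Longrightarrow> integrable M (\<lambda>\<omega>. exp (u * Y \<omega>))"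
  using dominated(1)[of "\<lambda>_. 1" uc u] critical_integrable(1) by simp

lemma Y_exp_integrable: "u \<le> uc \<Longrightarrow> integrable M (\<lambda>\<omega>. Y \<omega> * exp (u * Y \<omega>))"
  using dominated(1)[OF Y_measurable Y_nonneg critical_integrable(2)] .

lemma mgf_continuous: "continuous_on {..uc} mgf"
  using dominated(2)[of "\<lambda>_. 1" uc] critical_integrable(1) by (simp add: mgf_def[abs_def])

lemma dmgf_continuous: "continuous_on {..uc} dmgf"
  using dominated(2)[OF Y_measurable Y_nonneg critical_integrable(2)] by (simp add: dmgf_def[abs_def])

lemma dmgf_tendsto_0: "(\<lambda>n. dmgf (- real n)) \<longlonglongrightarrow> 0"
  using dominated(3)[OF Y_measurable Y_nonneg critical_integrable(2)] by (simp add: dmgf_def)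

lemma dmgf_uc: "a * dmgf uc = 1"
proof -
  have eq: "mark_exp Y a \<theta>c xc = (\<lambda>\<omega>. exp (uc * Y \<omega>))" by (simp add: mark_exp_eq uc_def)
  have "(\<integral>\<omega>. a * (Y \<omega> * exp (uc * Y \<omega>)) \<partial>M) = 1"
    using critical eq by (simp add: is_critical_pair_def mult.assoc)
  then show ?thesis by (simp add: dmgf_def)
qed

lemma tilt_uc: "tilt uc = \<theta>c"
  using critical unfolding is_critical_pair_def solves_g_def mark_exp_eq uc_def[symmetric] mgf_def[symmetric]
  by (simp add: tilt_def) (simp add: uc_def)

lemma mgf_0: "mgf 0 = 1"
  by (simp add: mgf_def prob_space)

lemma tilt_0: "tilt 0 = 0"
  by (simp add: tilt_def mgf_0)

lemma mgf_nonneg: "0 \<le> mgf u"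
  by (simp add: mgf_def)

lemma dmgf_nonneg: "0 \<le> dmgf u"
  unfolding dmgf_def using Y_nonneg by (intro integral_nonneg_AE) (auto elim: eventually_mono)

lemma dmgf_mono: "u \<le> v \<Longrightarrow> v \<le> uc \<Longrightarrow> dmgf u \<le> dmgf v"
  unfolding dmgf_def
proof (rule integral_mono_AE)
  assume uv: "u \<le> v" "v \<le> uc"
  then show "integrable M (\<lambda>\<omega>. Y \<omega> * exp (u * Y \<omega>))" "integrable M (\<lambda>\<omega>. Y \<omega> * exp (v * Y \<omega>))"
    by (auto intro: Y_exp_integrable)
  show "AE \<omega> in M. Y \<omega> * exp (u * Y \<omega>) \<le> Y \<omega> * exp (v * Y \<omega>)"
    using Y_nonneg by eventually_elim (use uv in \<open>auto intro!: mult_left_mono mult_right_mono\<close>)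
qed

text \<open>The pointwise inequality is strict because Y is almost surely nonzero, and strictness
  survives integration over a space of mass 1. This is the strict convexity of
  \<open>mgf\<close>.\<close>

lemma mgf_tangent_less:
  assumes "u \<le> uc" "v \<le> uc" "u \<noteq> v"
  shows "dmgf u * (v - u) < mgf v - mgf u"
proof -
  have "dmgf u * (v - u) = (\<integral>\<omega>. Y \<omega> * exp (u * Y \<omega>) * (v - u) \<partial>M)"
    by (simp add: dmgf_def)
  also have "\<dots> < (\<integral>\<omega>. exp (v * Y \<omega>) - exp (u * Y \<omega>) \<partial>M)"
  proof (rule integral_less_AE_space)
    show "AE \<omega> in M. Y \<omega> * exp (u * Y \<omega>) * (v - u) < exp (v * Y \<omega>) - exp (u * Y \<omega>)"
      using Y_pos by eventually_elim (use assms in \<open>auto intro!: exp_tangent_less\<close>)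
    show "emeasure M (space M) \<noteq> 0" by (simp add: emeasure_space_1)
  qed (use assms in \<open>auto intro!: exp_integrable Y_exp_integrable Bochner_Integration.integrable_diff\<close>)
  also have "\<dots> = mgf v - mgf u"
    using assms by (simp add: mgf_def exp_integrable)
  finally show ?thesis .
qed

lemma mgf_tangent_le:
  assumes "u \<le> uc" "v \<le> uc"
  shows "dmgf u * (v - u) \<le> mgf v - mgf u"
  using mgf_tangent_less[OF assms] by (cases "u = v") auto

lemma mgf_mono:
  assumes "u \<le> v" "v \<le> uc"
  shows "mgf u \<le> mgf v"
proof -
  have "0 \<le> dmgf u * (v - u)" using dmgf_nonneg assms by simp
  also have "\<dots> \<le> mgf v - mgf u" using assms by (intro mgf_tangent_le) auto
  finally show ?thesis by simp
qed

text \<open>An increment of \<open>a * mgf\<close> is strictly less than \<open>v - u\<close> times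
  \<open>a * dmgf v\<close>, which is at most \<open>a * dmgf uc = 1\<close>. Strictness persists
  for v = uc, where the slope of \<open>tilt\<close> is 0.\<close>

lemma tilt_less:
  assumes "u < v" "v \<le> uc"
  shows "tilt u < tilt v"
proof -
  have "dmgf v * (u - v) < mgf u - mgf v" using assms by (intro mgf_tangent_less) auto
  then have "a * (mgf v - mgf u) < a * (dmgf v * (v - u))"
    using a_pos by (intro mult_strict_left_mono) (auto simp: algebra_simps)
  also have "\<dots> = a * dmgf v * (v - u)" by simp
  also have "\<dots> \<le> a * dmgf uc * (v - u)"
    using assms a_pos dmgf_mono[of v uc] by (intro mult_right_mono mult_left_mono) auto
  finally show ?thesis using dmgf_uc by (simp add: tilt_def algebra_simps)
qed

lemma tilt_le: "u \<le> v \<Longrightarrow> v \<le> uc \<Longrightarrow> tilt u \<le> tilt v"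
  using tilt_less by (cases "u = v") (auto intro: less_imp_le)

lemma tilt_inj: "tilt u = tilt v \<Longrightarrow> u \<le> uc \<Longrightarrow> v \<le> uc \<Longrightarrow> u = v"
  using tilt_less by (metis less_irrefl linorder_neqE_linordered_idom)

lemma tilt_surj:
  assumes "\<theta> \<le> \<theta>c"
  obtains u where "u \<le> uc" "tilt u = \<theta>"
proof -
  \<comment> \<open>As \<open>mgf\<close> is nonnegative, \<open>tilt w \<le> w + a\<close>; hence
    \<theta> - a as left end for the intermediate value theorem.\<close>
  define w where "w = min uc (\<theta> - a)"
  have "tilt w \<le> \<theta>"
  proof -
    have "0 \<le> a * mgf w" using a_pos mgf_nonneg by simp
    then show ?thesis by (simp add: tilt_def w_def algebra_simps)
  qed
  moreover have "continuous_on {w..uc} tilt"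
    unfolding tilt_def[abs_def]
    by (intro continuous_intros continuous_on_subset[OF mgf_continuous]) auto
  ultimately have "\<exists>u\<ge>w. u \<le> uc \<and> tilt u = \<theta>"
    using assms by (intro IVT') (auto simp: tilt_uc w_def)
  then show ?thesis using that by blast
qed

text \<open>For nonpositive u the value \<open>dmgf u\<close> is at most the mean of Y, so
  subcriticality would force \<open>a * dmgf uc < 1\<close>.\<close>

lemma uc_pos: "0 < uc"
proof (rule ccontr)
  assume "\<not> 0 < uc"
  then have uc: "uc \<le> 0" by simp
  have "dmgf uc \<le> (\<integral>\<omega>. Y \<omega> \<partial>M)"
    unfolding dmgf_def
  proof (rule integral_mono_AE[OF critical_integrable(2) Y_integrable])
    show "AE \<omega> in M. Y \<omega> * exp (uc * Y \<omega>) \<le> Y \<omega>"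
      using Y_nonneg by eventually_elim (use uc in \<open>auto intro!: mult_left_le simp: mult_nonpos_nonneg\<close>)
  qed
  then have "a * dmgf uc \<le> a * (\<integral>\<omega>. Y \<omega> \<partial>M)" using a_pos by simp
  then show False using dmgf_uc subcritical by simp
qed

lemma dmgf_0: "dmgf 0 = (\<integral>\<omega>. Y \<omega> \<partial>M)"
  by (simp add: dmgf_def)

lemma Y_mean_pos: "0 < (\<integral>\<omega>. Y \<omega> \<partial>M)"
  using integral_less_AE_space[OF integrable_zero Y_integrable Y_pos] by (simp add: emeasure_space_1)

lemma \<theta>c_pos: "0 < \<theta>c"
  using tilt_less[of 0 uc] uc_pos by (simp add: tilt_0 tilt_uc)

lemma solves_g_iff: "solves_g M Y a \<theta> x \<longleftrightarrow>
    integrable M (\<lambda>\<omega>. exp ((\<theta> + a * (x - 1)) * Y \<omega>)) \<and> x = mgf (\<theta> + a * (x - 1))"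
  by (simp add: solves_g_def mark_exp_eq mgf_def)

text \<open>Solutions at the same \<theta> with exponents u and v differ by
  \<open>(v - u) / a\<close>. Strict monotonicity of \<open>tilt\<close> excludes an exponent v
  below u; beyond \<open>uc\<close> there may be another one, but it gives a larger solution. So the
  branch up to \<open>uc\<close> is the minimal one.\<close>

lemma g_L_tilt:
  assumes u: "u \<le> uc"
  shows "g_L M Y a (tilt u) = mgf u"
  unfolding g_L_def
proof (rule Least_equality)
  show "solves_g M Y a (tilt u) (mgf u)"
    using exp_integrable[OF u] by (simp add: solves_g_iff tilt_def)
  fix x assume x: "solves_g M Y a (tilt u) x"
  define v where "v = tilt u + a * (x - 1)"
  have xv: "x = mgf v" using x by (simp add: solves_g_iff v_def)
  then have tv: "tilt v = tilt u" by (simp add: tilt_def v_def)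
  have "u \<le> v"
  proof (rule ccontr)
    assume "\<not> u \<le> v"
    then show False using tilt_less[of v u] u tv by simp
  qed
  then have "0 \<le> a * (x - mgf u)"
    by (simp add: v_def tilt_def algebra_simps)
  then show "mgf u \<le> x" using a_pos by (simp add: zero_le_mult_iff)
qed

lemma Gamma_L_tilt: "u \<le> uc \<Longrightarrow> Gamma_L M Y a \<nu> (tilt u) = \<nu> * (mgf u - 1)"
  by (simp add: Gamma_L_def g_L_tilt)

text \<open>In terms of v the left side is \<open>x * v - (\<nu> + a * x) * (mgf v - 1)\<close>, a
  concave function, and the condition on \<open>dmgf u\<close> says that it is stationary at
  u.\<close>

lemma tangent_line:
  assumes "0 < \<nu>" "0 \<le> x" "u \<le> uc" "v \<le> uc" and u: "dmgf u = x / (\<nu> + a * x)"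
  shows "tilt v * x - Gamma_L M Y a \<nu> (tilt v) \<le> tilt u * x - Gamma_L M Y a \<nu> (tilt u)"
proof -
  have pos: "0 < \<nu> + a * x" using assms a_pos by (simp add: add_pos_nonneg)
  have "(\<nu> + a * x) * (dmgf u * (v - u)) \<le> (\<nu> + a * x) * (mgf v - mgf u)"
    using mgf_tangent_le[OF assms(3,4)] pos by simp
  moreover have "(\<nu> + a * x) * (dmgf u * (v - u)) = x * (v - u)"
    using pos by (simp add: u)
  ultimately have "tilt v * x - \<nu> * (mgf v - 1) \<le> tilt u * x - \<nu> * (mgf u - 1)"
    by (simp add: tilt_def algebra_simps)
  then show ?thesis using assms by (simp add: Gamma_L_tilt)
qed

lemma dmgf_surj:
  assumes "0 < c" "c < dmgf uc"
  obtains u where "u < uc" "dmgf u = c"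
proof -
  have "eventually (\<lambda>n. dmgf (- real n) < c) sequentially"
    using dmgf_tendsto_0 assms(1) by (rule order_tendstoD)
  moreover have "eventually (\<lambda>n. - uc \<le> real n) sequentially"
    using filterlim_real_sequentially by (simp add: filterlim_at_top)
  ultimately obtain n where n: "dmgf (- real n) < c" "- uc \<le> real n"
    by (metis (mono_tags, lifting) eventually_conj eventually_sequentially order_refl)
  have "\<exists>u\<ge>- real n. u \<le> uc \<and> dmgf u = c"
    using n assms by (intro IVT') (auto intro: continuous_on_subset[OF dmgf_continuous])
  then obtain u where "u \<le> uc" "dmgf u = c" by blast
  then show ?thesis using that assms by (metis less_irrefl order_le_less)
qed

lemma dmgf_right:
  assumes "u < uc" "dmgf u < K"
  obtains v where "u < v" "v \<le> uc" "dmgf v < K"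
proof -
  have "(dmgf \<longlongrightarrow> dmgf u) (at u within {..uc})"
    using dmgf_continuous assms by (simp add: continuous_on_def)
  then have "eventually (\<lambda>v. dmgf v < K) (at u within {..uc})"
    using assms(2) by (rule order_tendstoD)
  then obtain d where d: "0 < d" "\<And>v. v \<le> uc \<Longrightarrow> v \<noteq> u \<Longrightarrow> dist v u < d \<Longrightarrow> dmgf v < K"
    by (auto simp: eventually_at)
  define v where "v = min uc (u + d / 2)"
  have "u < v" "v \<le> uc" "dist v u < d" using assms d(1) by (auto simp: v_def dist_real_def)
  then show ?thesis using that d(2)[of v] by auto
qed

lemma dmgf_left:
  assumes "u < uc" "K < dmgf u"
  obtains v where "v < u" "K < dmgf v"
proof -
  have "(dmgf \<longlongrightarrow> dmgf u) (at u within {..uc})"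
    using dmgf_continuous assms by (simp add: continuous_on_def)
  then have "eventually (\<lambda>v. K < dmgf v) (at u within {..uc})"
    using assms(2) by (rule order_tendstoD)
  then obtain d where d: "0 < d" "\<And>v. v \<le> uc \<Longrightarrow> v \<noteq> u \<Longrightarrow> dist v u < d \<Longrightarrow> K < dmgf v"
    by (auto simp: eventually_at)
  define v where "v = u - d / 2"
  have "v < u" "v \<le> uc" "dist v u < d" using assms d(1) by (auto simp: v_def dist_real_def)
  then show ?thesis using that d(2)[of v] by auto
qed

lemma slope_less:
  assumes "0 < \<nu>" "0 \<le> x" "x < y"
  shows "x / (\<nu> + a * x) < y / (\<nu> + a * y)"
proof -
  have "0 < \<nu> + a * x" "0 < \<nu> + a * y" using assms a_pos by (auto simp: add_pos_nonneg)
  moreover have "x * (\<nu> + a * y) < y * (\<nu> + a * x)" using assms by (simp add: algebra_simps)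
  ultimately show ?thesis by (simp add: divide_less_eq less_divide_eq field_simps)
qed

text \<open>The right half of \<open>exposed\<close>. Since \<open>x + \<delta>\<close> corresponds
  to a strictly larger value of \<open>dmgf\<close>, continuity leaves room for some v > u still
  below it, and the tangent at v bounds the whole increment from u to v. The step h is the increment
  of \<open>tilt\<close>.\<close>

lemma Gamma_L_slope_right:
  assumes "0 < \<nu>" "0 \<le> x" "u < uc" and u: "dmgf u = x / (\<nu> + a * x)" and "0 < \<delta>"
  shows "\<exists>h>0. tilt u + h \<le> \<theta>c \<and>
    Gamma_L M Y a \<nu> (tilt u + h) - Gamma_L M Y a \<nu> (tilt u) < h * (x + \<delta>)"
proof -
  have pos: "0 < \<nu> + a * (x + \<delta>)" using assms a_pos by (simp add: add_pos_nonneg)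
  have "dmgf u < (x + \<delta>) / (\<nu> + a * (x + \<delta>))"
    unfolding u using assms by (intro slope_less) auto
  then obtain v where v: "u < v" "v \<le> uc" "dmgf v < (x + \<delta>) / (\<nu> + a * (x + \<delta>))"
    using assms(3) dmgf_right by blast
  have "mgf v - mgf u \<le> dmgf v * (v - u)"
    using mgf_tangent_le[of v u] v assms by (simp add: algebra_simps)
  also have "\<dots> < (x + \<delta>) / (\<nu> + a * (x + \<delta>)) * (v - u)"
    using v by (intro mult_strict_right_mono) auto
  finally have "(\<nu> + a * (x + \<delta>)) * (mgf v - mgf u) < (x + \<delta>) * (v - u)"
    using pos by (simp add: field_simps)
  then have "\<nu> * (mgf v - 1) - \<nu> * (mgf u - 1) < (tilt v - tilt u) * (x + \<delta>)"
    by (simp add: tilt_def algebra_simps)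
  moreover have "tilt v \<le> \<theta>c" using tilt_le[of v uc] v tilt_uc by simp
  ultimately show ?thesis
    using v tilt_less[of u v] assms by (intro exI[of _ "tilt v - tilt u"]) (simp add: Gamma_L_tilt)
qed

lemma Gamma_L_slope_left:
  assumes "0 < \<nu>" "0 < x" "u < uc" and u: "dmgf u = x / (\<nu> + a * x)" and "0 < \<delta>"
  shows "\<exists>h>0. Gamma_L M Y a \<nu> (tilt u - h) - Gamma_L M Y a \<nu> (tilt u) < - h * (x - \<delta>)"
proof -
  \<comment> \<open>Lowering x by at most x / 2 keeps y positive, so that \<open>slope_less\<close>
    applies; a larger \<delta> only weakens the claim.\<close>
  define y where "y = x - min \<delta> (x / 2)"
  have y: "0 < y" "y < x" "x - \<delta> \<le> y" using assms by (auto simp: y_def)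
  have pos: "0 < \<nu> + a * y" using assms y a_pos by (simp add: add_pos_nonneg)
  have "y / (\<nu> + a * y) < dmgf u"
    unfolding u using assms y by (intro slope_less) auto
  then obtain v where v: "v < u" "y / (\<nu> + a * y) < dmgf v"
    using assms(3) dmgf_left by blast
  have "y / (\<nu> + a * y) * (u - v) < dmgf v * (u - v)"
    using v by (intro mult_strict_right_mono) auto
  also have "\<dots> \<le> mgf u - mgf v"
    using mgf_tangent_le[of v u] v assms by simp
  finally have "y * (u - v) < (\<nu> + a * y) * (mgf u - mgf v)"
    using pos by (simp add: field_simps)
  then have *: "\<nu> * (mgf v - 1) - \<nu> * (mgf u - 1) < - (tilt u - tilt v) * y"
    by (simp add: tilt_def algebra_simps)
  have h: "0 < tilt u - tilt v" using tilt_less[of v u] v assms by simp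
  have "(tilt u - tilt v) * (x - \<delta>) \<le> (tilt u - tilt v) * y"
    using h y by (intro mult_left_mono) auto
  with * have "\<nu> * (mgf v - 1) - \<nu> * (mgf u - 1) < - (tilt u - tilt v) * (x - \<delta>)"
    by linarith
  with h show ?thesis
    using v assms by (intro exI[of _ "tilt u - tilt v"]) (simp add: Gamma_L_tilt)
qed

end

section \<open>The recursion for the exponents and its limit\<close>

locale critical_recursion = critical_mark +
  fixes \<alpha> :: "nat \<Rightarrow> real"
  assumes \<alpha>_pos: "\<And>t. 1 \<le> t \<Longrightarrow> 0 < \<alpha> t"
    and \<alpha>_summable: "summable (\<lambda>t. \<alpha> (Suc t))"
    and a_eq: "a = norm1 \<alpha>"
begin

text \<open>The coefficient that \<open>X (t - k)\<close> carries once the k later steps have been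
  integrated out; it does not depend on t.\<close>

function expo :: "real \<Rightarrow> nat \<Rightarrow> real" where
  "expo \<theta> k = \<theta> + (\<Sum>j<k. \<alpha> (k - j) * (mgf (expo \<theta> j) - 1))"
  by auto
termination by (relation "Wellfounded.measure snd") auto

declare expo.simps [simp del]

lemma \<alpha>_nonneg: "0 < t \<Longrightarrow> 0 \<le> \<alpha> t"
  using \<alpha>_pos[of t] by simp

lemma \<alpha>_partial: "(\<Sum>j<k. \<alpha> (k - j)) \<le> a"
proof -
  have "(\<Sum>j<k. \<alpha> (k - j)) = (\<Sum>j<k. \<alpha> (Suc (k - Suc j)))"
    by (intro sum.cong) (auto simp: Suc_diff_Suc)
  also have "\<dots> = (\<Sum>j<k. \<alpha> (Suc j))" by (rule sum.nat_diff_reindex)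
  also have "\<dots> \<le> a"
    unfolding a_eq norm1_def using \<alpha>_summable
    by (intro sum_le_suminf) (auto intro: \<alpha>_nonneg)
  finally show ?thesis .
qed

text \<open>The sign \<open>\<sigma>\<close> treats the increasing case \<open>u \<ge> 0\<close> and the decreasing case \<open>u \<le> 0\<close> at once.\<close>
lemma expo_bounds:
  assumes \<sigma>: "\<sigma> = 1 \<or> \<sigma> = - 1" and u: "0 \<le> \<sigma> * u" "u \<le> uc"
  shows "0 \<le> \<sigma> * expo (tilt u) k \<and> \<sigma> * expo (tilt u) k \<le> \<sigma> * u"
proof (induction k rule: less_induct)
  case (less k)
  have uc: "0 \<le> uc" using uc_pos by simp
  have t0: "0 \<le> \<sigma> * tilt u"
    using \<sigma> u tilt_le[of 0 u] tilt_le[of u 0] uc by (auto simp: tilt_0)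
  have m: "0 \<le> \<sigma> * (mgf (expo (tilt u) j) - 1)" "\<sigma> * (mgf (expo (tilt u) j) - 1) \<le> \<sigma> * (mgf u - 1)"
    if "j < k" for j
    using less[OF that] \<sigma> u uc mgf_0 mgf_mono[of 0 "expo (tilt u) j"] mgf_mono[of "expo (tilt u) j" 0]
      mgf_mono[of u "expo (tilt u) j"] mgf_mono[of "expo (tilt u) j" u]
    by auto
  have eq: "\<sigma> * expo (tilt u) k = \<sigma> * tilt u + (\<Sum>j<k. \<alpha> (k - j) * (\<sigma> * (mgf (expo (tilt u) j) - 1)))"
    by (subst expo.simps) (simp add: algebra_simps sum_distrib_left)
  have m0: "0 \<le> \<sigma> * (mgf u - 1)"
    using \<sigma> u uc mgf_0 mgf_mono[of 0 u] mgf_mono[of u 0] by auto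
  have "(\<Sum>j<k. \<alpha> (k - j) * (\<sigma> * (mgf (expo (tilt u) j) - 1))) \<le> (\<Sum>j<k. \<alpha> (k - j) * (\<sigma> * (mgf u - 1)))"
    by (intro sum_mono mult_left_mono[OF m(2)]) (auto intro: \<alpha>_nonneg)
  also have "\<dots> = (\<Sum>j<k. \<alpha> (k - j)) * (\<sigma> * (mgf u - 1))" by (simp add: sum_distrib_right)
  also have "\<dots> \<le> a * (\<sigma> * (mgf u - 1))" by (rule mult_right_mono[OF \<alpha>_partial m0])
  \<comment> \<open>\<open>tilt u + a * (mgf u - 1) = u\<close>, so u is a barrier that the
    recursion does not cross.\<close>
  finally have "\<sigma> * expo (tilt u) k \<le> \<sigma> * u"
    unfolding eq by (simp add: tilt_def algebra_simps)
  moreover have "0 \<le> \<sigma> * expo (tilt u) k"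
    unfolding eq by (intro add_nonneg_nonneg t0 sum_nonneg mult_nonneg_nonneg m) (auto intro: \<alpha>_nonneg)
  ultimately show ?case by simp
qed

lemma expo_le_uc:
  assumes "\<theta> \<le> \<theta>c"
  shows "expo \<theta> k \<le> uc"
proof -
  obtain u where u: "u \<le> uc" "tilt u = \<theta>" using tilt_surj assms by blast
  show ?thesis
    using u uc_pos expo_bounds[of 1 u k] expo_bounds[of "-1" u k] by (cases "0 \<le> u") auto
qed

text \<open>After the shift from j to \<open>Suc j\<close> the convolution at \<open>Suc k\<close>
  has the same weights as the one at k, on values one step later, and one additional term, from j =
  0, of sign \<sigma>.\<close>

lemma expo_mono:
  assumes \<sigma>: "\<sigma> = 1 \<or> \<sigma> = - 1" and u: "0 \<le> \<sigma> * u" "u \<le> uc"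
  shows "\<sigma> * expo (tilt u) k \<le> \<sigma> * expo (tilt u) (Suc k)"
proof (induction k rule: less_induct)
  case (less k)
  have le: "expo (tilt u) j \<le> uc" for j
    using tilt_le[of u uc] u by (intro expo_le_uc) (auto simp: tilt_uc)
  have m: "\<sigma> * (mgf (expo (tilt u) j) - 1) \<le> \<sigma> * (mgf (expo (tilt u) (Suc j)) - 1)" if "j < k" for j
    using less[OF that] \<sigma> le[of j] le[of "Suc j"] mgf_mono by auto
  have m0: "0 \<le> \<sigma> * (mgf (expo (tilt u) 0) - 1)"
    using expo_bounds[OF assms, of 0] \<sigma> le[of 0] uc_pos mgf_0
      mgf_mono[of 0 "expo (tilt u) 0"] mgf_mono[of "expo (tilt u) 0" 0] by auto
  have eq: "\<sigma> * expo (tilt u) k = \<sigma> * tilt u + (\<Sum>j<k. \<alpha> (k - j) * (\<sigma> * (mgf (expo (tilt u) j) - 1)))" for k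
    by (subst expo.simps) (simp add: algebra_simps sum_distrib_left)
  have "(\<Sum>j<k. \<alpha> (k - j) * (\<sigma> * (mgf (expo (tilt u) j) - 1)))
      \<le> (\<Sum>j<k. \<alpha> (k - j) * (\<sigma> * (mgf (expo (tilt u) (Suc j)) - 1)))"
    by (intro sum_mono mult_left_mono[OF m]) (auto intro: \<alpha>_nonneg)
  also have "\<dots> \<le> \<alpha> (Suc k) * (\<sigma> * (mgf (expo (tilt u) 0) - 1)) + \<dots>"
    using \<alpha>_pos[of "Suc k"] m0 by simp
  also have "\<dots> = (\<Sum>j<Suc k. \<alpha> (Suc k - j) * (\<sigma> * (mgf (expo (tilt u) j) - 1)))"
    by (subst sum.lessThan_Suc_shift) simp
  finally show ?case unfolding eq[of k] eq[of "Suc k"] by simp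
qed

text \<open>A contraction argument would fail at u = uc, where \<open>a * dmgf u = 1\<close>.
  Instead the limit exists by monotonicity and boundedness, solves the limiting equation, lies at or
  below \<open>uc\<close>, and is identified there by injectivity of \<open>tilt\<close>.\<close>

lemma expo_tendsto:
  assumes u: "u \<le> uc"
  shows "(\<lambda>k. expo (tilt u) k) \<longlonglongrightarrow> u"
proof -
  define \<sigma> :: real where "\<sigma> = (if 0 \<le> u then 1 else - 1)"
  have \<sigma>: "\<sigma> = 1 \<or> \<sigma> = - 1" "0 \<le> \<sigma> * u" "\<sigma> * \<sigma> = 1" by (auto simp: \<sigma>_def)
  have le: "expo (tilt u) j \<le> uc" for j
    using tilt_le[of u uc] u by (intro expo_le_uc) (auto simp: tilt_uc)
  have "incseq (\<lambda>k. \<sigma> * expo (tilt u) k)"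
    using expo_mono[OF \<sigma>(1,2) u] by (rule incseq_SucI)
  then obtain L where "(\<lambda>k. \<sigma> * expo (tilt u) k) \<longlonglongrightarrow> L"
    using incseq_convergent[of "\<lambda>k. \<sigma> * expo (tilt u) k" "\<sigma> * u"] expo_bounds[OF \<sigma>(1,2) u] by blast
  then have "(\<lambda>k. \<sigma> * (\<sigma> * expo (tilt u) k)) \<longlonglongrightarrow> \<sigma> * L" by (intro tendsto_intros)
  then have lim: "(\<lambda>k. expo (tilt u) k) \<longlonglongrightarrow> \<sigma> * L"
    using \<sigma>(3) by (simp add: mult.assoc[symmetric])
  have Lle: "\<sigma> * L \<le> uc" using lim le by (intro LIMSEQ_le_const2) auto
  have "(\<lambda>k. mgf (expo (tilt u) k)) \<longlonglongrightarrow> mgf (\<sigma> * L)"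
    using continuous_on_tendsto_compose[OF mgf_continuous lim] Lle le by simp
  then have "(\<lambda>k. mgf (expo (tilt u) k) - 1) \<longlonglongrightarrow> mgf (\<sigma> * L) - 1" by (intro tendsto_intros)
  moreover have "summable (\<lambda>s. \<bar>\<alpha> (Suc s)\<bar>)"
    using \<alpha>_summable \<alpha>_pos by (simp add: abs_of_pos)
  ultimately have "(\<lambda>k. \<Sum>j<k. \<alpha> (k - j) * (mgf (expo (tilt u) j) - 1)) \<longlonglongrightarrow> a * (mgf (\<sigma> * L) - 1)"
    unfolding a_eq norm1_def by (intro convolution_tendsto)
  then have "(\<lambda>k. tilt u + (\<Sum>j<k. \<alpha> (k - j) * (mgf (expo (tilt u) j) - 1))) \<longlonglongrightarrow> tilt u + a * (mgf (\<sigma> * L) - 1)"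
    by (intro tendsto_intros)
  then have "(\<lambda>k. expo (tilt u) k) \<longlonglongrightarrow> tilt u + a * (mgf (\<sigma> * L) - 1)"
    by (subst expo.simps)
  with lim have "\<sigma> * L = tilt u + a * (mgf (\<sigma> * L) - 1)" by (rule LIMSEQ_unique)
  then have "tilt (\<sigma> * L) = tilt u" unfolding tilt_def[of "\<sigma> * L"] by linarith
  then have "\<sigma> * L = u" using Lle u by (rule tilt_inj)
  with lim show ?thesis by simp
qed

lemma cumulant_tendsto:
  assumes "\<theta> \<le> \<theta>c"
  shows "(\<lambda>t. \<nu> * (\<Sum>k<t. mgf (expo \<theta> k) - 1) / real t) \<longlonglongrightarrow> Gamma_L M Y a \<nu> \<theta>"
proof -
  obtain u where u: "u \<le> uc" "tilt u = \<theta>" using tilt_surj assms by blast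
  have "(\<lambda>k. mgf (expo \<theta> k)) \<longlonglongrightarrow> mgf u"
    using continuous_on_tendsto_compose[OF mgf_continuous expo_tendsto[OF u(1)]] u expo_le_uc[OF assms] by auto
  then have "(\<lambda>k. mgf (expo \<theta> k) - 1) \<longlonglongrightarrow> mgf u - 1" by (intro tendsto_intros)
  then have "(\<lambda>t. \<nu> * ((\<Sum>k<t. mgf (expo \<theta> k) - 1) / real t)) \<longlonglongrightarrow> \<nu> * (mgf u - 1)"
    by (intro tendsto_mult_left cesaro_mean)
  then show ?thesis using Gamma_L_tilt[OF u(1)] u(2) by simp
qed

end

section \<open>Exponential moments of the Hawkes process\<close>

context prob_space
begin

lemma nn_integral_indep_set:
  fixes f g :: "'a \<Rightarrow> ennreal"
  assumes ind: "indep_set A B"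
    and f: "f \<in> borel_measurable M" "\<And>D. D \<in> sets borel \<Longrightarrow> f -` D \<inter> space M \<in> A"
    and g: "g \<in> borel_measurable M" "\<And>D. D \<in> sets borel \<Longrightarrow> g -` D \<inter> space M \<in> B"
  shows "(\<integral>\<^sup>+\<omega>. f \<omega> * g \<omega> \<partial>M) = (\<integral>\<^sup>+\<omega>. f \<omega> \<partial>M) * (\<integral>\<^sup>+\<omega>. g \<omega> \<partial>M)"
proof -
  \<comment> \<open>Preimages of Borel sets already form a sigma-algebra, so independence of the
    families \<open>A\<close> and \<open>B\<close> passes to the sigma-algebras generated by f and
    g.\<close>
  have sig: "sigma_sets (space M) {h -` D \<inter> space M |D. D \<in> sets borel} = {h -` D \<inter> space M |D. D \<in> sets borel}"
    for h :: "'a \<Rightarrow> ennreal"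
    using sigma_sets_vimage_commute[of h "space M" UNIV "sets borel"] sets.sigma_sets_eq[of "borel :: ennreal measure"]
    by simp
  have "indep_set {f -` D \<inter> space M |D. D \<in> sets borel} {g -` D \<inter> space M |D. D \<in> sets borel}"
    using ind unfolding indep_set_def
    by (rule indep_sets_mono_sets) (use f(2) g(2) in \<open>auto split: bool.split\<close>)
  then have "indep_var borel f borel g"
    unfolding indep_var_eq sig using f(1) g(1) by simp
  then have "indep_vars (\<lambda>_. borel) (case_bool f g) UNIV"
    by (simp add: indep_var_def cong: bool.case_cong) (erule back_subst[of "\<lambda>b. indep_vars b _ _"], auto split: bool.split)
  from indep_vars_nn_integral[OF _ this] show ?thesis
    by (simp add: UNIV_bool mult.commute)
qed

text \<open>W may be unbounded, so integrability, on which the integral property of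
  \<open>real_cond_exp\<close> rests, can fail. The nonnegative version is free of it, and the two
  agree here because the conditional expectation of an indicator is at most 1.\<close>

lemma real_cond_exp_nn_integral:
  assumes sub: "subalgebra M F" and [measurable]: "A \<in> sets M" and W: "W \<in> borel_measurable F"
    and p: "AE \<omega> in M. real_cond_exp M F (indicator A) \<omega> = p \<omega>"
  shows "(\<integral>\<^sup>+\<omega>. W \<omega> * indicator A \<omega> \<partial>M) = (\<integral>\<^sup>+\<omega>. W \<omega> * ennreal (p \<omega>) \<partial>M)"
proof -
  interpret finite_measure_subalgebra M F
    by standard (rule sub)
  \<comment> \<open>This bound excludes the value infinity, which \<open>enn2real\<close> would send
    to 0.\<close>
  have "AE \<omega> in M. nn_cond_exp M F (indicator A) \<omega> \<le> nn_cond_exp M F (\<lambda>_. 1) \<omega>"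
    by (rule nn_cond_exp_mono) (auto simp: indicator_def)
  moreover have "AE \<omega> in M. 1 = nn_cond_exp M F (\<lambda>_. 1) \<omega>"
    by (rule nn_cond_exp_F_meas) simp
  moreover have "AE \<omega> in M. 0 = nn_cond_exp M F (\<lambda>_. 0) \<omega>"
    by (rule nn_cond_exp_F_meas) simp
  ultimately have "AE \<omega> in M. nn_cond_exp M F (indicator A) \<omega> = ennreal (p \<omega>)"
    using p
  proof eventually_elim
    case (elim \<omega>)
    have 1: "(\<lambda>x. ennreal (indicator A x)) = indicator A" by (auto simp: indicator_def)
    have 2: "(\<lambda>x. ennreal (- indicat_real A x)) = (\<lambda>_. 0)" by (auto simp: indicator_def ennreal_neg)
    have "enn2real (nn_cond_exp M F (indicator A) \<omega>) = p \<omega>"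
      using elim unfolding real_cond_exp_def 1 2 by simp
    moreover have "nn_cond_exp M F (indicator A) \<omega> \<noteq> \<top>"
      using elim by (metis ennreal_one_neq_top top_unique)
    ultimately show ?case by (metis ennreal_enn2real less_top)
  qed
  then have "(\<integral>\<^sup>+\<omega>. W \<omega> * ennreal (p \<omega>) \<partial>M) = (\<integral>\<^sup>+\<omega>. W \<omega> * nn_cond_exp M F (indicator A) \<omega> \<partial>M)"
    by (intro nn_integral_cong_AE) (auto elim: eventually_mono)
  also have "\<dots> = (\<integral>\<^sup>+\<omega>. W \<omega> * indicator A \<omega> \<partial>M)"
    using W by (rule nn_cond_exp_intg) measurable
  finally show ?thesis by simp
qed

end

text \<open>The probability generating function of the Poisson law, from the exponential series of
  \<open>r * q\<close>.\<close>

lemma suminf_poisson_power: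
  fixes r :: real
  assumes "0 < r" "0 \<le> q"
  shows "(\<Sum>k. ennreal (pmf (poisson_pmf r) k) * ennreal q ^ k) = ennreal (exp (r * (q - 1)))"
proof -
  have "(\<lambda>k. (r * q) ^ k /\<^sub>R fact k) sums exp (r * q)" by (rule exp_converges)
  then have "(\<lambda>k. exp (- r) * ((r * q) ^ k /\<^sub>R fact k)) sums (exp (- r) * exp (r * q))"
    by (rule sums_mult)
  moreover have "exp (- r) * ((r * q) ^ k /\<^sub>R fact k) = pmf (poisson_pmf r) k * q ^ k" for k
    using assms by (simp add: power_mult_distrib divide_inverse mult_ac)
  moreover have "exp (- r) * exp (r * q) = exp (r * (q - 1))"
    by (simp add: mult_exp_exp algebra_simps)
  ultimately have sums: "(\<lambda>k. pmf (poisson_pmf r) k * q ^ k) sums exp (r * (q - 1))" by simp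
  have "ennreal (pmf (poisson_pmf r) k) * ennreal q ^ k = ennreal (pmf (poisson_pmf r) k * q ^ k)" for k
    using assms(2) by (simp only: ennreal_power ennreal_mult pmf_nonneg zero_le_power)
  moreover have "(\<Sum>k. ennreal (pmf (poisson_pmf r) k * q ^ k)) = ennreal (\<Sum>k. pmf (poisson_pmf r) k * q ^ k)"
    using sums_summable[OF sums] assms(2) by (intro suminf_ennreal2) (simp_all only: pmf_nonneg zero_le_power mult_nonneg_nonneg)
  ultimately show ?thesis using sums_unique[OF sums] by simp
qed

section \<open>Integrating out one step of the Hawkes process\<close>

context marked_hawkes
begin

lemma mark_measurable [measurable]: "1 \<le> t \<Longrightarrow> 1 \<le> j \<Longrightarrow> l t j \<in> borel_measurable M"
  using marks_indep unfolding indep_vars_def by force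

lemma X_measurable [measurable]: "X t \<in> borel_measurable M"
proof (cases "t = 0")
  case True
  then have "X t = (\<lambda>_. 0)" by (auto simp: X_0)
  then show ?thesis by simp
next
  case False
  then have Z: "Z t \<in> measurable M (count_space UNIV)" by (intro Z_measurable) simp
  have "(\<lambda>\<omega>. (\<lambda>k \<omega>. \<Sum>j=1..k. l t j \<omega>) (Z t \<omega>) \<omega>) \<in> borel_measurable M"
    by (rule measurable_compose_countable[OF _ Z]) (use False in \<open>auto intro!: borel_measurable_sum mark_measurable\<close>)
  also have "(\<lambda>\<omega>. (\<lambda>k \<omega>. \<Sum>j=1..k. l t j \<omega>) (Z t \<omega>) \<omega>) = X t"
    using X_eq[of t] False by (auto simp del: One_nat_def)
  finally show ?thesis .
qed

lemma X_nonneg: "AE \<omega> in M. \<forall>t. 0 \<le> X t \<omega>"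
proof -
  have "AE \<omega> in M. \<forall>t j. 1 \<le> t \<longrightarrow> 1 \<le> j \<longrightarrow> 0 < l t j \<omega>"
    unfolding AE_all_countable using marks_pos by auto
  then show ?thesis
  proof eventually_elim
    case (elim \<omega>)
    show ?case
    proof
      fix t show "0 \<le> X t \<omega>"
      proof (cases "t = 0")
        case False
        then have "0 \<le> (\<Sum>j=1..Z t \<omega>. l t j \<omega>)"
          using elim by (intro sum_nonneg less_imp_le) auto
        then show ?thesis using False X_eq[of t \<omega>] by simp
      qed (simp add: X_0)
    qed
  qed
qed

text \<open>Marks are positive only almost surely, hence so is the intensity. Positivity is what
  lets \<open>poisson_pmf\<close> be replaced by its explicit weights.\<close>

lemma intensity_pos: "AE \<omega> in M. 0 < hawkes_intensity \<nu> \<alpha> X t \<omega>"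
  using X_nonneg
proof eventually_elim
  case (elim \<omega>)
  have "0 \<le> (\<Sum>s=1..t-1. \<alpha> s * X (t - s) \<omega>)"
    using elim alpha_pos by (intro sum_nonneg mult_nonneg_nonneg) (auto intro: less_imp_le)
  then show ?case using nu_pos by (simp add: hawkes_intensity_def)
qed

lemma sets_history: "sets (history M Z X t) = sigma_sets (space M)
    ({Z s -` A \<inter> space M |s A. s \<in> {1..t}} \<union>
      {X s -` B \<inter> space M |s B. s \<in> {1..t} \<and> B \<in> sets borel})"
  unfolding history_def by (rule sets_measure_of) auto

lemma space_history: "space (history M Z X t) = space M"
  unfolding history_def by (rule space_measure_of) auto

lemma history_subalgebra: "subalgebra M (history M Z X t)"
  unfolding subalgebra_def space_history sets_history
proof (intro conjI refl sets.sigma_sets_subset Un_least subsetI)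
  fix S assume "S \<in> {Z s -` A \<inter> space M |s A. s \<in> {1..t}}"
  then show "S \<in> sets M" by (auto intro!: measurable_sets[OF Z_measurable])
next
  fix S assume "S \<in> {X s -` B \<inter> space M |s B. s \<in> {1..t} \<and> B \<in> sets borel}"
  then show "S \<in> sets M" by (auto intro!: measurable_sets[OF X_measurable])
qed

lemma X_measurable_history:
  assumes "s \<le> t"
  shows "X s \<in> borel_measurable (history M Z X t)"
proof (cases "s = 0")
  case True
  then have "X s = (\<lambda>_. 0)" by (auto simp: X_0)
  then show ?thesis by simp
next
  case False
  show ?thesis
  proof (rule measurableI)
    fix B :: "real set" assume "B \<in> sets borel"
    then show "X s -` B \<inter> space (history M Z X t) \<in> sets (history M Z X t)"
      using False assms unfolding space_history sets_history
      by (intro sigma_sets.Basic UnI2 CollectI exI[of _ s] exI[of _ B]) auto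
  qed auto
qed

lemma nn_mgf_marks:
  assumes t: "1 \<le> t" and int: "integrable M (\<lambda>\<omega>. exp (u * l 1 1 \<omega>))"
  shows "(\<integral>\<^sup>+\<omega>. ennreal (exp (u * (\<Sum>j=1..k. l t j \<omega>))) \<partial>M) = ennreal (\<integral>\<omega>. exp (u * l 1 1 \<omega>) \<partial>M) ^ k"
proof -
  define J where "J = Pair t ` {1..k}"
  have "indep_vars (\<lambda>_. borel) (\<lambda>(t, j). l t j) J"
    using marks_indep by (rule indep_vars_subset) (use t in \<open>auto simp: J_def\<close>)
  then have ind: "indep_vars (\<lambda>_. borel) (\<lambda>p \<omega>. ennreal (exp (u * (case p of (t, j) \<Rightarrow> l t j) \<omega>))) J"
    by (rule indep_vars_compose2) measurable
  have prod: "(\<Prod>p\<in>J. h (snd p)) = (\<Prod>j\<in>{1..k}. h j)" for h :: "nat \<Rightarrow> ennreal"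
    unfolding J_def by (subst prod.reindex) (auto intro: inj_onI)
  have one: "(\<integral>\<^sup>+\<omega>. ennreal (exp (u * l t j \<omega>)) \<partial>M) = ennreal (\<integral>\<omega>. exp (u * l 1 1 \<omega>) \<partial>M)" if j: "1 \<le> j" for j
  proof -
    have "(\<integral>\<^sup>+\<omega>. ennreal (exp (u * l t j \<omega>)) \<partial>M) = (\<integral>\<^sup>+y. ennreal (exp (u * y)) \<partial>distr M borel (l t j))"
      using t j by (subst nn_integral_distr) auto
    also have "\<dots> = (\<integral>\<^sup>+\<omega>. ennreal (exp (u * l 1 1 \<omega>)) \<partial>M)"
      unfolding marks_ident[OF t j] by (subst nn_integral_distr) auto
    also have "\<dots> = ennreal (\<integral>\<omega>. exp (u * l 1 1 \<omega>) \<partial>M)"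
      by (rule nn_integral_eq_integral[OF int]) simp
    finally show ?thesis .
  qed
  have "(\<integral>\<^sup>+\<omega>. ennreal (exp (u * (\<Sum>j=1..k. l t j \<omega>))) \<partial>M)
      = (\<integral>\<^sup>+\<omega>. (\<Prod>j\<in>{1..k}. ennreal (exp (u * l t j \<omega>))) \<partial>M)"
    by (simp add: sum_distrib_left exp_sum prod_ennreal)
  also have "\<dots> = (\<integral>\<^sup>+\<omega>. (\<Prod>p\<in>J. ennreal (exp (u * (case p of (t, j) \<Rightarrow> l t j) \<omega>))) \<partial>M)"
    unfolding prod[symmetric] by (intro nn_integral_cong prod.cong) (auto simp: J_def)
  also have "\<dots> = (\<Prod>p\<in>J. \<integral>\<^sup>+\<omega>. ennreal (exp (u * (case p of (t, j) \<Rightarrow> l t j) \<omega>)) \<partial>M)"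
    by (rule indep_vars_nn_integral[OF _ ind]) (auto simp: J_def)
  also have "\<dots> = (\<Prod>j\<in>{1..k}. \<integral>\<^sup>+\<omega>. ennreal (exp (u * l t j \<omega>)) \<partial>M)"
    unfolding prod[symmetric] by (intro prod.cong) (auto simp: J_def)
  also have "\<dots> = (\<Prod>j\<in>{1..k}. ennreal (\<integral>\<omega>. exp (u * l 1 1 \<omega>) \<partial>M))"
    by (intro prod.cong refl one) simp
  also have "\<dots> = ennreal (\<integral>\<omega>. exp (u * l 1 1 \<omega>) \<partial>M) ^ k" by simp
  finally show ?thesis .
qed

text \<open>This is the compound Poisson transform given the past, in integrated form. Splitting by
  the value k of \<open>Z t\<close> makes the number of summands deterministic: independence turns
  the marks into the k-th power of their transform, the conditional law supplies the Poisson weight,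
  and resumming gives the exponential. Nonnegative integrals allow every exchange, whatever the size
  of W.\<close>

lemma nn_integral_step:
  assumes t: "1 \<le> t" and int: "integrable M (\<lambda>\<omega>. exp (u * l 1 1 \<omega>))"
    and W: "W \<in> borel_measurable (history M Z X (t - 1))"
  shows "(\<integral>\<^sup>+\<omega>. W \<omega> * ennreal (exp (u * X t \<omega>)) \<partial>M)
    = (\<integral>\<^sup>+\<omega>. W \<omega> * ennreal (exp (hawkes_intensity \<nu> \<alpha> X t \<omega> * ((\<integral>\<omega>. exp (u * l 1 1 \<omega>) \<partial>M) - 1))) \<partial>M)"
proof -
  let ?F = "history M Z X (t - 1)"
  let ?q = "\<integral>\<omega>. exp (u * l 1 1 \<omega>) \<partial>M"
  define I where "I k = Z t -` {k} \<inter> space M" for k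
  have [measurable]: "Z t \<in> measurable M (count_space UNIV)" using t by (rule Z_measurable)
  have I [measurable]: "I k \<in> sets M" for k unfolding I_def by measurable
  have WM [measurable]: "W \<in> borel_measurable M"
    using W history_subalgebra measurable_from_subalg by blast
  have lM [measurable]: "(\<lambda>\<omega>. \<Sum>j=1..k. l t j \<omega>) \<in> borel_measurable M" for k
    using t by (auto intro!: borel_measurable_sum)
  have [measurable]: "hawkes_intensity \<nu> \<alpha> X t \<in> borel_measurable M"
    unfolding hawkes_intensity_def[abs_def] by measurable
  have split: "W \<omega> * ennreal (exp (u * X t \<omega>))
      = (\<Sum>k. W \<omega> * indicator (I k) \<omega> * ennreal (exp (u * (\<Sum>j=1..k. l t j \<omega>))))" if "\<omega> \<in> space M" for \<omega>
  proof -
    have "(\<Sum>k. W \<omega> * indicator (I k) \<omega> * ennreal (exp (u * (\<Sum>j=1..k. l t j \<omega>))))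
        = (\<Sum>k\<in>{Z t \<omega>}. W \<omega> * indicator (I k) \<omega> * ennreal (exp (u * (\<Sum>j=1..k. l t j \<omega>))))"
      by (rule suminf_finite) (auto simp: I_def)
    then show ?thesis using that t by (simp add: I_def X_eq)
  qed
  have "(\<integral>\<^sup>+\<omega>. W \<omega> * ennreal (exp (u * X t \<omega>)) \<partial>M)
      = (\<integral>\<^sup>+\<omega>. (\<Sum>k. W \<omega> * indicator (I k) \<omega> * ennreal (exp (u * (\<Sum>j=1..k. l t j \<omega>)))) \<partial>M)"
    by (intro nn_integral_cong split)
  also have "\<dots> = (\<Sum>k. \<integral>\<^sup>+\<omega>. W \<omega> * indicator (I k) \<omega> * ennreal (exp (u * (\<Sum>j=1..k. l t j \<omega>))) \<partial>M)"
    by (rule nn_integral_suminf) measurable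
  also have "\<dots> = (\<Sum>k. (\<integral>\<^sup>+\<omega>. W \<omega> * indicator (I k) \<omega> \<partial>M) * ennreal ?q ^ k)"
  proof (rule suminf_cong)
    fix k
    define A where "A = sigma (space M) (sets ?F \<union> {Z t -` A \<inter> space M |A. True})"
    define B where "B = sigma (space M) {l t j -` B \<inter> space M |j B. 1 \<le> j \<and> B \<in> sets borel}"
    have F_sub: "sets ?F \<subseteq> Pow (space M)"
      using sets.space_closed[of ?F] by (simp add: space_history)
    have A: "space A = space M" "sets A = sigma_sets (space M) (sets ?F \<union> {Z t -` A \<inter> space M |A. True})"
      unfolding A_def using F_sub by (auto intro!: space_measure_of sets_measure_of)
    have B: "space B = space M" "sets B = sigma_sets (space M) {l t j -` B \<inter> space M |j B. 1 \<le> j \<and> B \<in> sets borel}"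
      unfolding B_def by (auto intro!: space_measure_of sets_measure_of)
    have "subalgebra A ?F"
      unfolding subalgebra_def space_history A by (auto intro: sigma_sets.Basic)
    then have [measurable]: "W \<in> borel_measurable A" using W measurable_from_subalg by blast
    have [measurable]: "I k \<in> sets A" unfolding A I_def by (intro sigma_sets.Basic UnI2) auto
    have fA: "(\<lambda>\<omega>. W \<omega> * indicator (I k) \<omega>) \<in> borel_measurable A" by measurable
    have lB [measurable]: "l t j \<in> borel_measurable B" if "1 \<le> j" for j
    proof (rule measurableI)
      fix D :: "real set" assume "D \<in> sets borel"
      then show "l t j -` D \<inter> space B \<in> sets B"
        unfolding B using that by (intro sigma_sets.Basic) auto
    qed auto
    have [measurable]: "(\<lambda>\<omega>. \<Sum>j=1..k. l t j \<omega>) \<in> borel_measurable B"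
      by (intro borel_measurable_sum lB) auto
    have gB: "(\<lambda>\<omega>. ennreal (exp (u * (\<Sum>j=1..k. l t j \<omega>)))) \<in> borel_measurable B" by measurable
    have "(\<integral>\<^sup>+\<omega>. W \<omega> * indicator (I k) \<omega> * ennreal (exp (u * (\<Sum>j=1..k. l t j \<omega>))) \<partial>M)
        = (\<integral>\<^sup>+\<omega>. W \<omega> * indicator (I k) \<omega> \<partial>M) * (\<integral>\<^sup>+\<omega>. ennreal (exp (u * (\<Sum>j=1..k. l t j \<omega>))) \<partial>M)"
    proof (rule nn_integral_indep_set)
      show "indep_set (sets A) (sets B)" unfolding A B by (rule marks_indep_past[OF t])
      show "(\<lambda>\<omega>. W \<omega> * indicator (I k) \<omega>) -` D \<inter> space M \<in> sets A" if "D \<in> sets borel" for D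
        using measurable_sets[OF fA that] by (simp add: A(1))
      show "(\<lambda>\<omega>. ennreal (exp (u * (\<Sum>j=1..k. l t j \<omega>)))) -` D \<inter> space M \<in> sets B" if "D \<in> sets borel" for D
        using measurable_sets[OF gB that] by (simp only: B(1))
    qed measurable
    then show "(\<integral>\<^sup>+\<omega>. W \<omega> * indicator (I k) \<omega> * ennreal (exp (u * (\<Sum>j=1..k. l t j \<omega>))) \<partial>M)
        = (\<integral>\<^sup>+\<omega>. W \<omega> * indicator (I k) \<omega> \<partial>M) * ennreal ?q ^ k"
      by (simp only: nn_mgf_marks[OF t int])
  qed
  also have "\<dots> = (\<Sum>k. \<integral>\<^sup>+\<omega>. W \<omega> * ennreal (pmf (poisson_pmf (hawkes_intensity \<nu> \<alpha> X t \<omega>)) k) * ennreal ?q ^ k \<partial>M)"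
  proof (rule suminf_cong)
    fix k
    \<comment> \<open>Taking the conditional expectation itself as \<open>p\<close> keeps the
      integrand measurable; the Poisson weight replaces it afterwards, almost everywhere.\<close>
    have eq: "(\<integral>\<^sup>+\<omega>. W \<omega> * indicator (I k) \<omega> \<partial>M)
        = (\<integral>\<^sup>+\<omega>. W \<omega> * ennreal (real_cond_exp M ?F (indicator (I k)) \<omega>) \<partial>M)"
      by (rule real_cond_exp_nn_integral[OF history_subalgebra I W]) simp
    have "(\<integral>\<^sup>+\<omega>. W \<omega> * indicator (I k) \<omega> \<partial>M) * ennreal ?q ^ k
        = (\<integral>\<^sup>+\<omega>. W \<omega> * ennreal (real_cond_exp M ?F (indicator (I k)) \<omega>) * ennreal ?q ^ k \<partial>M)"
      unfolding eq by (rule nn_integral_multc[symmetric]) measurable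
    also have "\<dots> = (\<integral>\<^sup>+\<omega>. W \<omega> * ennreal (pmf (poisson_pmf (hawkes_intensity \<nu> \<alpha> X t \<omega>)) k) * ennreal ?q ^ k \<partial>M)"
      using Z_cond_poisson[OF t, of k] unfolding I_def
      by (intro nn_integral_cong_AE) (auto elim: eventually_mono)
    finally show "(\<integral>\<^sup>+\<omega>. W \<omega> * indicator (I k) \<omega> \<partial>M) * ennreal ?q ^ k = \<dots>" .
  qed
  \<comment> \<open>In explicit form the weights are visibly measurable in \<omega>, as the exchange
    of sum and integral requires.\<close>
  also have "\<dots> = (\<Sum>k. \<integral>\<^sup>+\<omega>. W \<omega> * ennreal (hawkes_intensity \<nu> \<alpha> X t \<omega> ^ k / fact k * exp (- hawkes_intensity \<nu> \<alpha> X t \<omega>)) * ennreal ?q ^ k \<partial>M)"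
    using intensity_pos[of t]
    by (intro suminf_cong nn_integral_cong_AE) (auto elim: eventually_mono)
  also have "\<dots> = (\<integral>\<^sup>+\<omega>. (\<Sum>k. W \<omega> * ennreal (hawkes_intensity \<nu> \<alpha> X t \<omega> ^ k / fact k * exp (- hawkes_intensity \<nu> \<alpha> X t \<omega>)) * ennreal ?q ^ k) \<partial>M)"
    by (rule nn_integral_suminf[symmetric]) measurable
  also have "\<dots> = (\<integral>\<^sup>+\<omega>. W \<omega> * ennreal (exp (hawkes_intensity \<nu> \<alpha> X t \<omega> * (?q - 1))) \<partial>M)"
  proof (rule nn_integral_cong_AE)
    show "AE \<omega> in M. (\<Sum>k. W \<omega> * ennreal (hawkes_intensity \<nu> \<alpha> X t \<omega> ^ k / fact k * exp (- hawkes_intensity \<nu> \<alpha> X t \<omega>)) * ennreal ?q ^ k)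
        = W \<omega> * ennreal (exp (hawkes_intensity \<nu> \<alpha> X t \<omega> * (?q - 1)))"
      using intensity_pos[of t]
    proof eventually_elim
      case (elim \<omega>)
      then have "(\<Sum>k. ennreal (hawkes_intensity \<nu> \<alpha> X t \<omega> ^ k / fact k * exp (- hawkes_intensity \<nu> \<alpha> X t \<omega>)) * ennreal ?q ^ k)
        = ennreal (exp (hawkes_intensity \<nu> \<alpha> X t \<omega> * (?q - 1)))"
        using suminf_poisson_power[OF elim, of ?q] by simp
      then show ?case by (simp only: mult.assoc ennreal_suminf_cmult)
    qed
  qed
  finally show ?thesis .
qed

end

section \<open>The transform of the cumulative marks and the large deviation principle\<close>

locale critical_hawkes = marked_hawkes M \<nu> \<alpha> l Z X + critical_recursion M Y a \<theta>c xc \<alpha>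
  for M :: "'a measure" and \<nu> \<alpha> l Z X Y a \<theta>c xc +
  assumes mark_eq: "l 1 1 = Y"
begin

text \<open>Integrating out \<open>X t, X (t - 1), \<dots>\<close> in turn, \<open>weight \<theta> t d s\<close> is the coefficient that \<open>X s\<close>
  has in the exponent once the last \<open>d\<close> steps are gone.\<close>
definition weight :: "real \<Rightarrow> nat \<Rightarrow> nat \<Rightarrow> nat \<Rightarrow> real" where
  "weight \<theta> t d s = \<theta> + (\<Sum>k<d. \<alpha> (t - k - s) * (mgf (expo \<theta> k) - 1))"

text \<open>The last remaining variable is \<open>X (t - d)\<close>, with coefficient
  \<open>expo \<theta> d\<close>. Integrating it out leaves the exponential of its intensity times
  \<open>q - 1\<close>; the baseline \<nu> joins the prefactor and the part from the past updates
  the weights. At d = t no variable is left.\<close>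

lemma nn_mgf_backwards:
  assumes \<theta>: "\<theta> \<le> \<theta>c"
  shows "d \<le> t \<Longrightarrow> (\<integral>\<^sup>+\<omega>. ennreal (exp (\<theta> * cumulative_marks X t \<omega>)) \<partial>M)
    = ennreal (exp (\<nu> * (\<Sum>k<d. mgf (expo \<theta> k) - 1)))
      * (\<integral>\<^sup>+\<omega>. ennreal (exp (\<Sum>s=1..t-d. weight \<theta> t d s * X s \<omega>)) \<partial>M)"
proof (induction d)
  case 0
  then show ?case by (simp add: weight_def cumulative_marks_def sum_distrib_left)
next
  case (Suc d)
  define n where "n = t - Suc d"
  define q where "q = mgf (expo \<theta> d)"
  have n: "t - d = Suc n" using Suc.prems by (simp add: n_def)
  define W where "W \<omega> = ennreal (exp (\<Sum>s=1..n. weight \<theta> t d s * X s \<omega>))" for \<omega>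
  have [measurable]: "(\<lambda>\<omega>. \<Sum>s=1..n. weight \<theta> t d s * X s \<omega>) \<in> borel_measurable (history M Z X (Suc n - 1))"
    by (intro borel_measurable_sum borel_measurable_times borel_measurable_const X_measurable_history) auto
  have W: "W \<in> borel_measurable (history M Z X (Suc n - 1))"
    unfolding W_def[abs_def] by measurable
  \<comment> \<open>The index \<open>t - k - Suc n\<close> equals \<open>d - k\<close>, so the
    weight is the defining sum of \<open>expo\<close>.\<close>
  have w: "weight \<theta> t d (Suc n) = expo \<theta> d"
  proof -
    have "t - k - Suc n = d - k" if "k < d" for k using n that by simp
    then show ?thesis by (simp add: weight_def expo.simps[of \<theta> d])
  qed
  have int: "integrable M (\<lambda>\<omega>. exp (expo \<theta> d * Y \<omega>))"
    by (intro exp_integrable expo_le_uc \<theta>)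
  \<comment> \<open>The intensity sums over lags; reversing the sum indexes it by the time of
    X.\<close>
  have lam: "hawkes_intensity \<nu> \<alpha> X (Suc n) \<omega> = \<nu> + (\<Sum>s=1..n. \<alpha> (Suc n - s) * X s \<omega>)" for \<omega>
    unfolding hawkes_intensity_def
    by (subst sum.atLeastAtMost_rev) (auto intro!: sum.cong)
  have weight_Suc: "weight \<theta> t (Suc d) s = weight \<theta> t d s + \<alpha> (Suc n - s) * (q - 1)" for s
    by (simp only: weight_def q_def sum.lessThan_Suc n add.assoc)
  have comb: "(\<Sum>s=1..n. weight \<theta> t d s * X s \<omega>) + hawkes_intensity \<nu> \<alpha> X (Suc n) \<omega> * (q - 1)
      = \<nu> * (q - 1) + (\<Sum>s=1..n. weight \<theta> t (Suc d) s * X s \<omega>)" for \<omega>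
    unfolding lam weight_Suc by (simp add: algebra_simps sum.distrib sum_distrib_left sum_subtractf)
  have "(\<integral>\<^sup>+\<omega>. ennreal (exp (\<Sum>s=1..t-d. weight \<theta> t d s * X s \<omega>)) \<partial>M)
      = (\<integral>\<^sup>+\<omega>. W \<omega> * ennreal (exp (expo \<theta> d * X (Suc n) \<omega>)) \<partial>M)"
    by (simp add: n W_def w exp_add ennreal_mult)
  also have "\<dots> = (\<integral>\<^sup>+\<omega>. W \<omega> * ennreal (exp (hawkes_intensity \<nu> \<alpha> X (Suc n) \<omega> * (q - 1))) \<partial>M)"
    unfolding q_def mgf_def
    using nn_integral_step[of "Suc n" "expo \<theta> d" W] int W by (simp only: mark_eq)
  also have "\<dots> = (\<integral>\<^sup>+\<omega>. ennreal (exp (\<nu> * (q - 1))) * ennreal (exp (\<Sum>s=1..n. weight \<theta> t (Suc d) s * X s \<omega>)) \<partial>M)"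
    unfolding W_def by (simp only: ennreal_mult[symmetric] exp_ge_zero exp_add[symmetric] comb)
  also have "\<dots> = ennreal (exp (\<nu> * (q - 1))) * (\<integral>\<^sup>+\<omega>. ennreal (exp (\<Sum>s=1..n. weight \<theta> t (Suc d) s * X s \<omega>)) \<partial>M)"
    by (rule nn_integral_cmult) measurable
  finally have step: "(\<integral>\<^sup>+\<omega>. ennreal (exp (\<Sum>s=1..t-d. weight \<theta> t d s * X s \<omega>)) \<partial>M) = \<dots>" .
  have "exp (\<nu> * (\<Sum>k<Suc d. mgf (expo \<theta> k) - 1)) = exp (\<nu> * (\<Sum>k<d. mgf (expo \<theta> k) - 1)) * exp (\<nu> * (q - 1))"
    by (simp add: q_def exp_add[symmetric] algebra_simps mult_exp_exp)
  then show ?case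
    using Suc step by (simp add: n_def[symmetric] ennreal_mult mult.assoc)
qed

lemma mgf_cumulative_marks:
  assumes "\<theta> \<le> \<theta>c"
  shows "has_bochner_integral M (\<lambda>\<omega>. exp (\<theta> * cumulative_marks X t \<omega>))
    (exp (\<nu> * (\<Sum>k<t. mgf (expo \<theta> k) - 1)))"
proof (rule has_bochner_integral_nn_integral)
  show "(\<lambda>\<omega>. exp (\<theta> * cumulative_marks X t \<omega>)) \<in> borel_measurable M"
    unfolding cumulative_marks_def by measurable
  show "(\<integral>\<^sup>+\<omega>. ennreal (exp (\<theta> * cumulative_marks X t \<omega>)) \<partial>M)
      = ennreal (exp (\<nu> * (\<Sum>k<t. mgf (expo \<theta> k) - 1)))"
    using nn_mgf_backwards[OF assms, of t t] by (simp add: emeasure_space_1)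
qed auto

sublocale cgf_limit M "cumulative_marks X" "\<lambda>t \<theta>. \<nu> * (\<Sum>k<t. mgf (expo \<theta> k) - 1)"
  "Gamma_L M Y a \<nu>" \<theta>c
proof
  show "cumulative_marks X t \<in> borel_measurable M" for t
    unfolding cumulative_marks_def[abs_def] by measurable
qed (use mgf_cumulative_marks cumulant_tendsto in \<open>auto simp: has_bochner_integral_iff\<close>)

lemma exposed_tilt:
  assumes "0 < x" "u < uc" "dmgf u = x / (\<nu> + a * x)"
  shows "exposed (tilt u) x"
  unfolding exposed_def
  using assms nu_pos tilt_le[of u uc] tilt_uc Gamma_L_slope_right[of \<nu> x u] Gamma_L_slope_left[of \<nu> x u]
  by auto

text \<open>Steepness: \<open>x / (\<nu> + a * x)\<close> stays below 1/a, the value of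
  \<open>dmgf\<close> at \<open>uc\<close>, so every positive x is a slope attained strictly before
  the critical point.\<close>

lemma slope_point:
  assumes "0 < x"
  obtains u where "u < uc" "dmgf u = x / (\<nu> + a * x)"
proof (rule dmgf_surj)
  have pos: "0 < \<nu> + a * x" using assms nu_pos a_pos by (simp add: add_pos_pos)
  show "0 < x / (\<nu> + a * x)" using assms pos by simp
  have "a * (x / (\<nu> + a * x)) < 1" using nu_pos pos by (simp add: field_simps)
  then show "x / (\<nu> + a * x) < dmgf uc" using dmgf_uc a_pos by (metis mult_less_cancel_left_pos)
qed (use that in blast)

lemma rate_neg:
  assumes "x < 0"
  shows "rate x = \<infinity>"
proof (rule ereal_top)
  fix B :: real
  \<comment> \<open>As x is negative, \<theta> \<le> B / x makes \<open>\<theta> * x\<close> at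
    least B, while \<theta> \<le> 0 makes \<open>Gamma_L\<close> nonpositive.\<close>
  define \<theta> where "\<theta> = min 0 (B / x)"
  have \<theta>: "\<theta> \<le> \<theta>c" using \<theta>c_pos by (simp add: \<theta>_def)
  obtain u where u: "u \<le> uc" "tilt u = \<theta>" using tilt_surj \<theta> by blast
  have "u \<le> 0"
  proof (rule ccontr)
    assume "\<not> u \<le> 0"
    then show False using tilt_less[of 0 u] u by (simp add: tilt_0 \<theta>_def)
  qed
  then have "mgf u \<le> 1" using mgf_mono[of u 0] mgf_0 uc_pos by simp
  then have "Gamma_L M Y a \<nu> \<theta> \<le> 0"
    using Gamma_L_tilt[OF u(1)] u(2) nu_pos by (simp add: mult_nonneg_nonpos)
  moreover have "B \<le> \<theta> * x"
    using assms mult_right_mono_neg[of \<theta> "B / x" x] by (simp add: \<theta>_def)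
  ultimately have "ereal B \<le> ereal (\<theta> * x - Gamma_L M Y a \<nu> \<theta>)" by simp
  also have "\<dots> \<le> rate x" by (rule rate_upper[OF \<theta>])
  finally show "ereal B \<le> rate x" .
qed

lemma rate_eq_tilt:
  assumes "0 \<le> x" "u \<le> uc" "dmgf u = x / (\<nu> + a * x)"
  shows "rate x = ereal (tilt u * x - Gamma_L M Y a \<nu> (tilt u))"
proof (rule antisym)
  show "rate x \<le> ereal (tilt u * x - Gamma_L M Y a \<nu> (tilt u))"
    unfolding rate_def
  proof (rule SUP_least)
    fix \<theta> assume "\<theta> \<in> {..\<theta>c}"
    then obtain v where v: "v \<le> uc" "tilt v = \<theta>" using tilt_surj by auto
    show "ereal (\<theta> * x - Gamma_L M Y a \<nu> \<theta>) \<le> ereal (tilt u * x - Gamma_L M Y a \<nu> (tilt u))"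
      using tangent_line[OF nu_pos assms(1,2) v(1) assms(3)] v(2) by simp
  qed
  have "tilt u \<le> \<theta>c" using tilt_le[of u uc] assms tilt_uc by simp
  then show "ereal (tilt u * x - Gamma_L M Y a \<nu> (tilt u)) \<le> rate x" by (rule rate_upper)
qed

text \<open>The law of large numbers limit m, the solution of m = (\<nu> + a m) E[Y]; equivalently
  the slope of \<open>Gamma_L\<close> at 0.\<close>

definition mean :: real where
  "mean = \<nu> * (\<integral>\<omega>. Y \<omega> \<partial>M) / (1 - a * (\<integral>\<omega>. Y \<omega> \<partial>M))"

lemma mean_pos: "0 < mean" and dmgf_0_mean: "dmgf 0 = mean / (\<nu> + a * mean)"
proof -
  let ?m = "\<integral>\<omega>. Y \<omega> \<partial>M"
  have s: "0 < 1 - a * ?m" using subcritical by simp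
  show "0 < mean" unfolding mean_def using Y_mean_pos s nu_pos by (intro divide_pos_pos mult_pos_pos)
  have "\<nu> + a * mean = \<nu> / (1 - a * ?m)"
    unfolding mean_def using s by (simp add: field_simps)
  then show "dmgf 0 = mean / (\<nu> + a * mean)"
    unfolding dmgf_0 mean_def using s nu_pos by simp
qed

lemma cumulative_marks_LDP:
  "satisfies_LDP (\<lambda>t. distr M borel (\<lambda>\<omega>. cumulative_marks X t \<omega> / real t)) real
    (rate_L M Y a \<nu> \<theta>c)"
proof -
  have \<Gamma>0: "Gamma_L M Y a \<nu> 0 = 0"
    using Gamma_L_tilt[of 0 \<nu>] uc_pos by (simp add: tilt_0 mgf_0)
  have "satisfies_LDP (\<lambda>t. distr M borel (\<lambda>\<omega>. cumulative_marks X t \<omega> / real t)) real rate"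
  proof (rule LDP[OF \<theta>c_pos _ \<Gamma>0, of mean])
    show "\<theta> * mean \<le> Gamma_L M Y a \<nu> \<theta>" if \<theta>: "\<theta> \<le> \<theta>c" for \<theta>
    proof -
      obtain v where v: "v \<le> uc" "tilt v = \<theta>" using tilt_surj \<theta> by blast
      \<comment> \<open>The tangent to \<open>Gamma_L\<close> at \<theta> = 0, of slope
        \<open>mean\<close>, lies below it.\<close>
      show ?thesis
        using tangent_line[OF nu_pos less_imp_le[OF mean_pos] _ v(1) dmgf_0_mean] uc_pos v(2) \<Gamma>0 by (simp add: tilt_0)
    qed
    fix x G assume G: "open G" "x \<in> G" and fin: "rate x < \<infinity>"
    have "0 \<le> x" using rate_neg[of x] fin by (cases "x < 0") auto
    show "\<exists>y\<in>G. rate y \<le> rate x \<and> (\<exists>\<theta>. exposed \<theta> y)"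
    proof (cases "x = 0")
      case False
      then have "0 < x" using \<open>0 \<le> x\<close> by simp
      then show ?thesis using G slope_point exposed_tilt by (metis order_refl)
    next
      case True
      obtain d where d: "0 < d" "ball 0 d \<subseteq> G" using G True open_contains_ball by blast
      \<comment> \<open>0 is not the slope of any tilt. A nearby y below \<open>mean\<close> has
        exponent \<open>tilt u \<le> 0\<close>, so moving from y to 0 can only raise the
        rate.\<close>
      define y where "y = min (d / 2) (mean / 2)"
      have y: "0 < y" "y < mean" "y < d" using d(1) mean_pos by (auto simp: y_def)
      have yG: "y \<in> G" using d(2) y by (auto simp: dist_real_def)
      obtain u where u: "u < uc" "dmgf u = y / (\<nu> + a * y)" using slope_point y(1) by blast
      have "dmgf u < dmgf 0"
        using slope_less[OF nu_pos _ y(2)] y(1) u(2) dmgf_0_mean by simp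
      then have "u \<le> 0" using dmgf_mono[of 0 u] u(1) by (cases "u \<le> 0") auto
      then have tu: "tilt u \<le> 0" using tilt_le[of u 0] uc_pos tilt_0 by simp
      have tuc: "tilt u \<le> \<theta>c" using tu \<theta>c_pos by simp
      have "rate y = ereal (tilt u * y - Gamma_L M Y a \<nu> (tilt u))"
        using y u by (intro rate_eq_tilt) auto
      also have "\<dots> \<le> ereal (tilt u * x - Gamma_L M Y a \<nu> (tilt u))"
        using True tu y(1) by (simp add: mult_nonpos_nonneg)
      also have "\<dots> \<le> rate x" by (rule rate_upper[OF tuc])
      finally show ?thesis using yG exposed_tilt[OF y(1) u] by blast
    qed
  qed
  moreover have "rate = rate_L M Y a \<nu> \<theta>c"
    by (simp add: fun_eq_iff rate_def rate_L_def)
  ultimately show ?thesis by simp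
qed

end

theorem theorem2p2:
  fixes M :: "'a measure"
    and \<nu> :: real
    and \<alpha> :: "nat \<Rightarrow> real"
    and l :: "nat \<Rightarrow> nat \<Rightarrow> 'a \<Rightarrow> real"
    and Z :: "nat \<Rightarrow> 'a \<Rightarrow> nat"
    and X :: "nat \<Rightarrow> 'a \<Rightarrow> real"
    and \<theta>c xc :: real
  assumes "marked_hawkes M \<nu> \<alpha> l Z X"
    and "summable (\<lambda>t. \<alpha> (Suc t))"
    and "integrable M (l 1 1)"
    and "norm1 \<alpha> * (\<integral>\<omega>. l 1 1 \<omega> \<partial>M) < 1"
    and "0 < \<theta>c"
    and "is_critical_pair M (l 1 1) (norm1 \<alpha>) \<theta>c xc"
  shows "satisfies_LDP
           (\<lambda>t. distr M borel (\<lambda>\<omega>. cumulative_marks X t \<omega> / real t))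
           (\<lambda>t. real t)
           (rate_L M (l 1 1) (norm1 \<alpha>) \<nu> \<theta>c)"
proof -
  interpret marked_hawkes M \<nu> \<alpha> l Z X by fact
  have norm1_pos: "0 < norm1 \<alpha>"
    unfolding norm1_def using assms(2) alpha_pos by (intro suminf_pos) auto
  interpret critical_hawkes M \<nu> \<alpha> l Z X "l 1 1" "norm1 \<alpha>" \<theta>c xc
    by unfold_locales (use assms norm1_pos alpha_pos marks_pos[of 1 1] in auto)
  show ?thesis by (rule cumulative_marks_LDP)
qed

end
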